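(* Let $p,s$ be positive integers and let $\phi$ be a non-constant bounded radial function on $\mathbb{D}$. If there exists a bounded radial function $\psi$ such that $T_{e^{is\theta}\psi}$ commutes with $T_{e^{ip\theta}\phi}$ on $L^2_h$, then $\psi$ is unique up to a multiplicative constant; that is, if $\psi_1$ and $\psi_2$ are bounded radial functions on $\mathbb{D}$ such that both $T_{e^{is\theta}\psi_1}$ and $T_{e^{is\theta}\psi_2}$ commute with $T_{e^{ip\theta}\phi}$, then one of $\psi_1,\psi_2$ is a constant multiple of the other.
   Context: $\mathbb{D}$ is the open unit disk of the complex plane and $dA=r\,dr\,\frac{d\theta}{\pi}$ is normalized Lebesgue measure on $\mathbb{D}$. The harmonic Bergman space $L^2_h$ is the closed subspace of $L^2(\mathbb{D},dA)$ consisting of all harmonic functions on $\mathbb{D}$, and $Q$ is the orthogonal projection of $L^2(\mathbb{D},dA)$ onto $L^2_h$. For a bounded (measurable) function $f$ on $\mathbb{D}$, the Toeplitz operator $T_f:L^2_h\to L^2_h$ with symbol $f$ is $T_f(u)=Q(fu)$. A function $\phi$ on $\mathbb{D}$ is radial if $\phi(z)$ depends only on $r=|z|$; $e^{ip\theta}\phi$ denotes the function $re^{i\theta}\mapsto e^{ip\theta}\phi(r)$. Equality of symbols is understood almost everywhere. Constants are complex numbers. *)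

theory Defs
  imports "HOL-Analysis.Analysis"
begin

abbreviation disk :: "complex set" where
  "disk \<equiv> ball 0 1"

definition dA :: "complex measure" where
  "dA = density (lebesgue_on disk) (\<lambda>_. ennreal (1 / pi))"

text \<open>
  Complex-valued harmonic functions on an open set: twice continuously differentiable with
  vanishing Laplacian. The witnesses are the first and second partial derivatives of \<open>u\<close> in
  the real coordinates \<open>x = Re z\<close>, \<open>y = Im z\<close>.
\<close>

definition harmonic_on :: "complex set \<Rightarrow> (complex \<Rightarrow> complex) \<Rightarrow> bool" where
  "harmonic_on S u \<longleftrightarrow>
     (\<exists>ux uy uxx uxy uyx uyy.
        (\<forall>z\<in>S. (u has_derivative (\<lambda>h. Re h *\<^sub>R ux z + Im h *\<^sub>R uy z)) (at z) \<and>
               (ux has_derivative (\<lambda>h. Re h *\<^sub>R uxx z + Im h *\<^sub>R uxy z)) (at z) \<and>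
               (uy has_derivative (\<lambda>h. Re h *\<^sub>R uyx z + Im h *\<^sub>R uyy z)) (at z)) \<and>
        continuous_on S uxx \<and> continuous_on S uxy \<and>
        continuous_on S uyx \<and> continuous_on S uyy \<and>
        (\<forall>z\<in>S. uxx z + uyy z = 0))"

definition L2 :: "(complex \<Rightarrow> complex) set" where
  "L2 = {f. f \<in> borel_measurable dA \<and> integrable dA (\<lambda>z. (cmod (f z))\<^sup>2)}"

definition L2_inner :: "(complex \<Rightarrow> complex) \<Rightarrow> (complex \<Rightarrow> complex) \<Rightarrow> complex" where
  "L2_inner f g = (\<integral>z. f z * cnj (g z) \<partial>dA)"

text \<open>
  A harmonic function on the disk is represented by its extension by \<open>0\<close> to the whole plane.
  As harmonic functions are continuous, each class in the harmonic Bergman space then has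
  exactly one representative, so equality of its elements is equality of functions.
\<close>

definition L2h :: "(complex \<Rightarrow> complex) set" where
  "L2h = {u \<in> L2. harmonic_on disk u \<and> (\<forall>z. z \<notin> disk \<longrightarrow> u z = 0)}"

text \<open>Orthogonal projection of \<open>L2\<close> onto \<open>L2h\<close>; only meaningful for arguments in \<open>L2\<close>.\<close>

definition Q :: "(complex \<Rightarrow> complex) \<Rightarrow> complex \<Rightarrow> complex" where
  "Q f = (THE u. u \<in> L2h \<and> (\<forall>v\<in>L2h. L2_inner (\<lambda>z. f z - u z) v = 0))"

definition toeplitz :: "(complex \<Rightarrow> complex) \<Rightarrow> (complex \<Rightarrow> complex) \<Rightarrow> complex \<Rightarrow> complex" where
  "toeplitz f u = Q (\<lambda>z. f z * u z)"

definition toeplitz_commute :: "(complex \<Rightarrow> complex) \<Rightarrow> (complex \<Rightarrow> complex) \<Rightarrow> bool" where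
  "toeplitz_commute f g \<longleftrightarrow>
     (\<forall>u\<in>L2h. toeplitz f (toeplitz g u) = toeplitz g (toeplitz f u))"

definition bounded_symbol :: "(complex \<Rightarrow> complex) \<Rightarrow> bool" where
  "bounded_symbol f \<longleftrightarrow> f \<in> borel_measurable dA \<and> bounded (f ` disk)"

definition radial :: "(complex \<Rightarrow> complex) \<Rightarrow> bool" where
  "radial f \<longleftrightarrow> (\<forall>z\<in>disk. \<forall>w\<in>disk. cmod z = cmod w \<longrightarrow> f z = f w)"

text \<open>The function $e^{ip\theta}\phi$; the value at the origin, a null set, is immaterial.\<close>

definition quasihom :: "nat \<Rightarrow> (complex \<Rightarrow> complex) \<Rightarrow> complex \<Rightarrow> complex" where
  "quasihom p \<phi> z = exp (\<i> * of_nat p * of_real (Arg z)) * \<phi> z"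

lemma quasihom_polar:
  assumes "radial \<phi>" "0 < r" "r < 1"
  shows "quasihom p \<phi> (of_real r * exp (\<i> * of_real \<theta>))
           = exp (\<i> * of_nat p * of_real \<theta>) * \<phi> (of_real r)"
proof -
  define z where "z = complex_of_real r * exp (\<i> * of_real \<theta>)"
  have nz: "cmod z = r" using assms by (simp add: z_def norm_mult)
  hence "z \<noteq> 0" using assms by auto
  hence "z = of_real r * exp (\<i> * of_real (Arg z))"
    using Arg_eq[of z] nz by simp
  hence "exp (\<i> * of_real (Arg z)) = exp (\<i> * complex_of_real \<theta>)"
    using assms unfolding z_def by simp
  hence "exp (of_nat p * (\<i> * of_real (Arg z))) = exp (of_nat p * (\<i> * complex_of_real \<theta>))"
    by (simp only: exp_of_nat_mult)
  moreover have "\<phi> z = \<phi> (of_real r)"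
    using assms nz by (auto simp: radial_def dist_norm)
  ultimately show ?thesis
    unfolding quasihom_def z_def[symmetric] by (simp add: mult_ac)
qed

end

theory Submission
  imports Defs "HOL-Complex_Analysis.Complex_Analysis"
begin

text \<open>
  Put \<open>moment f x = \<integral> f |z|\<^sup>x dA\<close>. On the monomials \<open>z\<^sup>n\<close> the operator with symbol \<open>e\<^sup>i\<^sup>p\<^sup>\<theta> \<phi>\<close> is a
  weighted shift whose weights are quotients of moments, so that commutation is an identity between
  products of three moments at the even integers. A product of moments is itself a moment on a
  product space, and by the Weierstrass theorem moments vanishing along an arithmetic progression
  vanish for all larger exponents; so the identity holds for all real \<open>x > 2\<close>. Comparing it for
  \<open>\<psi>1\<close> and \<open>\<psi>2\<close> shows that the quotient of their moments has period \<open>2p\<close> away from the zeros of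
  the moments of \<open>\<phi>\<close> and \<open>\<psi>2\<close>. These zeros are countable, as moments extend holomorphically to a
  half-plane. Hence some progression \<open>c + 2pk\<close> avoids them all, and there the quotient is a constant
  \<open>a\<close>. All higher moments of \<open>\<psi>1 - a \<psi>2\<close> then vanish, which for a radial function forces
  \<open>\<psi>1 = a \<psi>2\<close>.
\<close>

section \<open>Rotation invariance of area measure\<close>

text \<open>The obstacle is that moments of \<open>\<phi>\<close> or \<open>\<psi>2\<close> may
  vanish at some of the even integers where commutation says anything, and then the recursion
  relating the moments of \<open>\<psi>1\<close> and \<open>\<psi>2\<close> breaks there. Passing to
  real exponents gains the freedom to slide a whole progression off the zeros. The passage cannot be
  made factor by factor, since commutation controls only products of three moments; this is what
  forces the product space, where the exponent acts on the single variable
  \<open>\<bar>z1 z2 z3\<bar>\<close> in [0,1]. Because p and s are positive, both operators map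
  analytic monomials to multiples of analytic monomials, so these alone are tested; conjugate powers
  matter only when the projection is computed. Angular integration is done by rotation invariance
  instead of polar coordinates: an integral that equals a multiple of itself by a factor other than
  1 vanishes.\<close>

lemma lborel_complex_eq: "(lborel :: complex measure) = distr lborel borel (\<lambda>(x, y). Complex x y)"
proof (rule lborel_eqI)
  have m: "(\<lambda>(x, y). Complex x y) \<in> borel_measurable (borel :: (real \<times> real) measure)"
    by (intro borel_measurable_continuous_onI)
       (auto simp: case_prod_unfold Complex_eq intro!: continuous_intros)
  fix l u :: complex
  assume lu: "\<And>b. b \<in> Basis \<Longrightarrow> l \<bullet> b \<le> u \<bullet> b"
  have *: "(\<lambda>(x, y). Complex x y) -` box l u = box (Re l, Im l) (Re u, Im u)"
    by (auto simp: box_def Basis_complex_def Basis_prod_def inner_complex_def)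
  have le: "Re l \<le> Re u" "Im l \<le> Im u"
    using lu[of 1] lu[of \<i>] by (auto simp: Basis_complex_def)
  have "emeasure (distr lborel borel (\<lambda>(x, y). Complex x y)) (box l u)
      = emeasure lborel (box (Re l, Im l) (Re u, Im u))"
    using m by (subst emeasure_distr) (auto simp: *)
  also have "\<dots> = ennreal ((Re u - Re l) * (Im u - Im l))"
  proof -
    have b: "box (Re l, Im l) (Re u, Im u) = box (Re l) (Re u) \<times> box (Im l) (Im u)"
      by (auto simp: box_def Basis_prod_def)
    show ?thesis
      using le by (simp add: b lborel_prod[symmetric] lborel.emeasure_pair_measure_Times ennreal_mult)
  qed
  finally show "emeasure (distr lborel borel (\<lambda>(x, y). Complex x y)) (box l u)
     = ennreal (\<Prod>b\<in>Basis. (u - l) \<bullet> b)"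
    by (simp add: Basis_complex_def)
qed simp

text \<open>Both orders of integration are recorded, one for each shear below: a horizontal shear
  translates the inner integral over x, a vertical one that over y.\<close>

lemma nn_integral_lborel_complex:
  fixes f :: "complex \<Rightarrow> ennreal"
  assumes f [measurable]: "f \<in> borel_measurable borel"
  shows "(\<integral>\<^sup>+z. f z \<partial>lborel) = (\<integral>\<^sup>+y. \<integral>\<^sup>+x. f (Complex x y) \<partial>lborel \<partial>lborel)" (is "_ = ?A")
    and "(\<integral>\<^sup>+z. f z \<partial>lborel) = (\<integral>\<^sup>+x. \<integral>\<^sup>+y. f (Complex x y) \<partial>lborel \<partial>lborel)" (is "_ = ?B")
proof -
  have m [measurable]: "(\<lambda>p. Complex (fst p) (snd p)) \<in> borel_measurable (borel :: (real \<times> real) measure)"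
    by (intro borel_measurable_continuous_onI) (auto simp: Complex_eq intro!: continuous_intros)
  have m' [measurable]: "(\<lambda>p. Complex (fst p) (snd p)) \<in> borel_measurable (lborel \<Otimes>\<^sub>M lborel)"
    by (simp add: lborel_prod)
  have "(\<integral>\<^sup>+z. f z \<partial>lborel) = (\<integral>\<^sup>+p. f (Complex (fst p) (snd p)) \<partial>(lborel \<Otimes>\<^sub>M lborel))"
    by (subst lborel_complex_eq, subst nn_integral_distr) (auto simp: case_prod_unfold lborel_prod)
  then show "(\<integral>\<^sup>+z. f z \<partial>lborel) = ?A" "(\<integral>\<^sup>+z. f z \<partial>lborel) = ?B"
    using lborel_pair.nn_integral_snd[of "\<lambda>p. f (Complex (fst p) (snd p))"]
      lborel.nn_integral_fst[of "\<lambda>p. f (Complex (fst p) (snd p))" lborel]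
    by (simp_all)
qed

lemma nn_integral_shear:
  fixes f :: "complex \<Rightarrow> ennreal"
  assumes f [measurable]: "f \<in> borel_measurable borel"
  shows nn_integral_shear_Re: "(\<integral>\<^sup>+z. f (z + of_real (a * Im z)) \<partial>lborel) = (\<integral>\<^sup>+z. f z \<partial>lborel)"
    and nn_integral_shear_Im: "(\<integral>\<^sup>+z. f (z + \<i> * of_real (a * Re z)) \<partial>lborel) = (\<integral>\<^sup>+z. f z \<partial>lborel)"
proof -
  have [measurable]: "(\<lambda>x. Complex x y) \<in> borel_measurable borel" "(\<lambda>x. Complex y x) \<in> borel_measurable borel" for y
    by (intro borel_measurable_continuous_onI; auto simp: Complex_eq intro!: continuous_intros)+
  have "(\<integral>\<^sup>+x. f (Complex x y + of_real (a * y)) \<partial>lborel) = (\<integral>\<^sup>+x. f (Complex x y) \<partial>lborel)" for y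
    by (subst nn_integral_real_affine[of "\<lambda>x. f (Complex x y)" 1 "a * y"])
       (auto simp: Complex_eq algebra_simps)
  then show "(\<integral>\<^sup>+z. f (z + of_real (a * Im z)) \<partial>lborel) = (\<integral>\<^sup>+z. f z \<partial>lborel)"
    by (simp add: nn_integral_lborel_complex(1))
  have "(\<integral>\<^sup>+y. f (Complex x y + \<i> * of_real (a * x)) \<partial>lborel) = (\<integral>\<^sup>+y. f (Complex x y) \<partial>lborel)" for x
    by (subst nn_integral_real_affine[of "\<lambda>y. f (Complex x y)" 1 "a * x"])
       (auto simp: Complex_eq algebra_simps)
  then show "(\<integral>\<^sup>+z. f (z + \<i> * of_real (a * Re z)) \<partial>lborel) = (\<integral>\<^sup>+z. f z \<partial>lborel)"
    by (simp add: nn_integral_lborel_complex(2))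
qed

text \<open>A rotation other than by a half turn is a product of three shears.\<close>

lemma lborel_rotation:
  assumes w: "cmod w = 1" "Re w \<noteq> -1"
  shows "distr lborel borel (\<lambda>z. w * z) = lborel"
proof (rule measure_eqI)
  \<comment> \<open>For \<open>w = cis \<theta>\<close> these are
    \<open>t = - tan (\<theta> / 2)\<close> and \<open>s = sin \<theta>\<close>: a horizontal shear
    by t, a vertical one by s, and again the horizontal one.\<close>
  define t where "t = - Im w / (1 + Re w)"
  define s where "s = Im w"
  have ne: "1 + Re w \<noteq> 0" using w(2) by linarith
  have sq: "(Re w)\<^sup>2 + (Im w)\<^sup>2 = 1" using w(1) by (simp add: cmod_def)
  have ts: "1 + t * s = Re w"
    using ne sq by (simp add: t_def s_def field_simps power2_eq_square)
  have t2: "t * (1 + Re w) = - Im w"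
    using ne by (simp add: t_def)
  define S where "S = (\<lambda>z. z + complex_of_real (t * Im z))"
  define U where "U = (\<lambda>z. z + \<i> * complex_of_real (s * Re z))"
  have dec: "w * z = S (U (S z))" for z
  proof (rule complex_eqI)
    have "Re (S (U (S z))) = (1 + t * s) * Re z + t * (1 + (1 + t * s)) * Im z"
      by (simp add: S_def U_def algebra_simps)
    then show "Re (w * z) = Re (S (U (S z)))" unfolding ts t2 by simp
    have "Im (S (U (S z))) = (1 + t * s) * Im z + s * Re z"
      by (simp add: S_def U_def algebra_simps)
    then show "Im (w * z) = Im (S (U (S z)))" unfolding ts by (simp add: s_def)
  qed
  show "sets (distr lborel borel (\<lambda>z. w * z)) = sets lborel" by simp
  fix A assume "A \<in> sets (distr lborel borel (\<lambda>z. w * z))"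
  then have A [measurable]: "A \<in> sets borel" by simp
  have [measurable]: "S \<in> borel_measurable borel" "U \<in> borel_measurable borel"
    unfolding S_def U_def by measurable
  have "emeasure (distr lborel borel (\<lambda>z. w * z)) A = (\<integral>\<^sup>+z. indicator A (S (U (S z))) \<partial>lborel)"
    by (subst nn_integral_indicator[symmetric], simp, subst nn_integral_distr) (auto simp: dec)
  also have "\<dots> = (\<integral>\<^sup>+z. indicator A (S (U z)) \<partial>lborel)"
    using nn_integral_shear_Re[of "\<lambda>z. indicator A (S (U z))" t] by (simp add: S_def)
  also have "\<dots> = (\<integral>\<^sup>+z. indicator A (S z) \<partial>lborel)"
    using nn_integral_shear_Im[of "\<lambda>z. indicator A (S z)" s] by (simp add: U_def)
  also have "\<dots> = (\<integral>\<^sup>+z. indicator A z \<partial>lborel)"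
    using nn_integral_shear_Re[of "\<lambda>z. indicator A z" t] by (simp add: S_def)
  finally show "emeasure (distr lborel borel (\<lambda>z. w * z)) A = emeasure lborel A" by simp
qed

text \<open>Measurability into the completion requires more than Borel measurability: preimages of
  null sets must be null. Invariance of \<open>lborel\<close> supplies this.\<close>

lemma lebesgue_rotation:
  assumes w: "cmod w = 1" "Re w \<noteq> -1"
  shows "(\<lambda>z. w * z) \<in> lebesgue \<rightarrow>\<^sub>M lebesgue" "distr lebesgue lebesgue (\<lambda>z. w * z) = lebesgue"
proof -
  have m: "(\<lambda>z. w * z) \<in> lebesgue \<rightarrow>\<^sub>M lborel" by (simp add: measurable_completion)
  have d: "distr lebesgue lborel (\<lambda>z. w * z) = lborel"
    using lborel_rotation[OF w] by (simp add: distr_completion cong: distr_cong)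
  show "(\<lambda>z. w * z) \<in> lebesgue \<rightarrow>\<^sub>M lebesgue"
    using m d by (intro completion.measurable_completion2) auto
  show "distr lebesgue lebesgue (\<lambda>z. w * z) = lebesgue"
    using completion.completion_distr_eq[OF m] d by simp
qed

section \<open>Normalized area measure on the disk\<close>

lemma space_dA [simp]: "space dA = disk"
  by (simp add: dA_def)

lemma sets_dA [measurable_cong]: "sets dA = sets (lebesgue_on disk)"
  by (simp add: dA_def)

lemma emeasure_dA:
  assumes "A \<in> sets dA"
  shows "emeasure dA A = ennreal (1 / pi) * emeasure lebesgue A"
proof -
  have A: "A \<in> sets lebesgue" "A \<subseteq> disk"
    using assms by (auto simp: sets_dA sets_restrict_space_iff)
  have "emeasure dA A = ennreal (1 / pi) * emeasure (lebesgue_on disk) A"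
    using assms unfolding dA_def by (subst emeasure_density_const) auto
  also have "emeasure (lebesgue_on disk) A = emeasure lebesgue A"
    using A by (subst emeasure_restrict_space) auto
  finally show ?thesis .
qed

interpretation dA: finite_measure dA
proof
  have "emeasure lebesgue disk < \<infinity>"
    using emeasure_lborel_ball_finite[of "0 :: complex" 1] by simp
  then show "emeasure dA (space dA) \<noteq> \<infinity>"
    using emeasure_dA[OF sets.top[of dA]] by (simp add: ennreal_mult_eq_top_iff)
qed

lemma AE_dA_iff: "(AE z in dA. P z) \<longleftrightarrow> (AE z in lebesgue. z \<in> disk \<longrightarrow> P z)"
  unfolding dA_def by (subst AE_density) (auto simp: AE_restrict_space_iff)

lemma AE_dA_nonzero: "AE z in dA. z \<noteq> 0"
  unfolding AE_dA_iff using AE_lborel_singleton[of "0 :: complex"] 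
  by (auto intro: AE_completion elim: eventually_mono)

lemma borel_measurable_dA_continuous_on:
  fixes f :: "complex \<Rightarrow> 'a :: {second_countable_topology, real_normed_vector}"
  assumes "continuous_on disk f"
  shows "f \<in> borel_measurable dA"
  using continuous_imp_measurable_on_sets_lebesgue[OF assms]
  by (simp add: measurable_cong_sets[OF sets_dA refl])

lemma dA_rotation:
  assumes w: "cmod w = 1" "Re w \<noteq> -1"
  shows "(\<lambda>z. w * z) \<in> dA \<rightarrow>\<^sub>M dA" "distr dA dA (\<lambda>z. w * z) = dA"
proof -
  have "(\<lambda>z. w * z) \<in> lebesgue_on disk \<rightarrow>\<^sub>M lebesgue_on disk"
    using w lebesgue_rotation(1)[OF w]
    by (intro measurable_restrict_space3) (auto simp: norm_mult)
  then show m: "(\<lambda>z. w * z) \<in> dA \<rightarrow>\<^sub>M dA"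
    by (simp add: measurable_cong_sets[OF sets_dA sets_dA])
  show "distr dA dA (\<lambda>z. w * z) = dA"
  proof (rule measure_eqI)
    fix A assume "A \<in> sets (distr dA dA (\<lambda>z. w * z))"
    then have A: "A \<in> sets dA" by simp
    then have A': "A \<in> sets lebesgue" "A \<subseteq> disk"
      by (auto simp: sets_dA sets_restrict_space_iff)
    have eq: "(\<lambda>z. w * z) -` A \<inter> disk = (\<lambda>z. w * z) -` A \<inter> space lebesgue"
      using A'(2) w by (auto simp: norm_mult dest: subsetD)
    have "emeasure (distr dA dA (\<lambda>z. w * z)) A = emeasure dA ((\<lambda>z. w * z) -` A \<inter> disk)"
      using m A by (simp add: emeasure_distr)
    also have "\<dots> = ennreal (1 / pi) * emeasure lebesgue ((\<lambda>z. w * z) -` A \<inter> space lebesgue)"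
      using measurable_sets[OF m A] by (simp add: emeasure_dA eq[simplified])
    also have "\<dots> = ennreal (1 / pi) * emeasure (distr lebesgue lebesgue (\<lambda>z. w * z)) A"
      using A' lebesgue_rotation(1)[OF w] by (subst emeasure_distr) auto
    finally show "emeasure (distr dA dA (\<lambda>z. w * z)) A = emeasure dA A"
      by (simp add: lebesgue_rotation(2)[OF w] emeasure_dA[OF A])
  qed simp
qed

lemma integral_dA_rotation:
  fixes f :: "complex \<Rightarrow> complex"
  assumes "f \<in> borel_measurable dA" "cmod w = 1" "Re w \<noteq> -1"
  shows "(\<integral>z. f (w * z) \<partial>dA) = (\<integral>z. f z \<partial>dA)"
  using integral_distr[OF dA_rotation(1), of w f] dA_rotation(2)[of w] assms by simp

text \<open>The angle \<open>1 / k\<close> rotates a function of angular degree \<open>k\<close> by the factor \<open>exp \<i> \<noteq> 1\<close>.\<close>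

lemma integral_dA_eq_0_of_angular_degree:
  fixes f :: "complex \<Rightarrow> complex"
  assumes f: "f \<in> borel_measurable dA" and k: "k \<noteq> 0"
    and rot: "\<And>w z. cmod w = 1 \<Longrightarrow> z \<in> disk - {0} \<Longrightarrow> f (w * z) = w powi k * f z"
  shows "(\<integral>z. f z \<partial>dA) = 0"
proof -
  define w where "w = cis (1 / of_int k)"
  have w1: "cmod w = 1" by (simp add: w_def)
  \<comment> \<open>The angle stays within a quarter turn, which keeps \<open>w\<close> away from
    -1, where rotation invariance has not been established.\<close>
  have "\<bar>1 / of_int k\<bar> \<le> (1 :: real)"
    using k by (simp add: field_simps)
  then have "\<bar>1 / of_int k\<bar> < (pi / 2 :: real)"
    using pi_gt3 by linarith
  then have "cos (1 / of_int k) > (0::real)"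
    by (intro cos_gt_zero_pi) linarith+
  then have w2: "Re w \<noteq> -1" unfolding w_def by simp
  have wk: "w powi k = cis 1"
    using k by (simp add: w_def cis_power_int)
  have c1: "cis 1 \<noteq> 1"
  proof
    assume "cis 1 = 1"
    then have "sin 1 = (0::real)" by (simp add: complex_eq_iff)
    moreover have "sin 1 > (0::real)" using pi_gt3 by (intro sin_gt_zero) linarith+
    ultimately show False by simp
  qed
  have "(\<integral>z. f z \<partial>dA) = (\<integral>z. f (w * z) \<partial>dA)"
    using integral_dA_rotation[OF f w1 w2] by simp
  also have "\<dots> = (\<integral>z. cis 1 * f z \<partial>dA)"
  proof (rule integral_cong_AE)
    show "(\<lambda>z. f (w * z)) \<in> borel_measurable dA"
      using measurable_compose[OF dA_rotation(1)[OF w1 w2] f] .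
    show "(\<lambda>z. cis 1 * f z) \<in> borel_measurable dA" using f by measurable
    show "AE z in dA. f (w * z) = cis 1 * f z"
      using AE_dA_nonzero AE_space by eventually_elim (auto simp: rot[OF w1] wk)
  qed
  finally show ?thesis using c1 by simp
qed

section \<open>Moments along arithmetic progressions\<close>

lemma integrable_mult_bounded:
  fixes h b :: "'a \<Rightarrow> complex"
  assumes h: "integrable M h" and b: "b \<in> borel_measurable M"
    and B: "\<And>x. x \<in> space M \<Longrightarrow> norm (b x) \<le> B"
  shows "integrable M (\<lambda>x. h x * b x)"
proof (rule Bochner_Integration.integrable_bound)
  show "integrable M (\<lambda>x. B * norm (h x))" using h by auto
  show "(\<lambda>x. h x * b x) \<in> borel_measurable M" using h b by auto
  show "AE x in M. norm (h x * b x) \<le> norm (B * norm (h x))"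
  proof (rule AE_I2)
    fix x assume "x \<in> space M"
    then have "norm (h x) * norm (b x) \<le> norm (h x) * B"
      by (intro mult_left_mono B) auto
    then show "norm (h x * b x) \<le> norm (B * norm (h x))"
      by (simp add: norm_mult mult.commute)
  qed
qed

text \<open>A uniform error e in the test function changes the integral by at most e times the L1
  norm of \<open>h\<close>, so Stone-Weierstrass on the compact set \<open>S\<close> suffices. The
  map \<open>T\<close> into a Euclidean space allows two uses: with a variable in [0,1], and with
  the identity on the closed disk.\<close>

lemma integral_continuous_eq_0_of_polynomials:
  fixes h :: "'a \<Rightarrow> complex" and T :: "'a \<Rightarrow> 'b::euclidean_space" and g :: "'b \<Rightarrow> real"
  assumes h: "integrable M h" and T: "T \<in> borel_measurable M"
    and S: "\<And>x. x \<in> space M \<Longrightarrow> T x \<in> S" "compact S"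
    and poly: "\<And>p. real_polynomial_function p \<Longrightarrow> (\<integral>x. h x * of_real (p (T x)) \<partial>M) = 0"
    and g: "continuous_on S g"
  shows "(\<integral>x. h x * of_real (g (T x)) \<partial>M) = 0"
proof -
  have int: "integrable M (\<lambda>x. h x * of_real (f (T x)))" if f: "continuous_on S f" for f :: "'b \<Rightarrow> real"
  proof -
    have "bounded (f ` S)"
      using S(2) f compact_continuous_image compact_imp_bounded by blast
    then obtain B where B: "\<And>y. y \<in> S \<Longrightarrow> norm (f y) \<le> B"
      by (auto simp: bounded_iff)
    have "T \<in> M \<rightarrow>\<^sub>M restrict_space borel S"
      using T S(1) by (intro measurable_restrict_space2) auto
    from measurable_compose[OF this borel_measurable_continuous_on_restrict[OF f]]
    have "(\<lambda>x. f (T x)) \<in> borel_measurable M" .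
    then show ?thesis
      using S(1) B by (intro integrable_mult_bounded[OF h]) auto
  qed
  define I where "I = (\<integral>x. norm (h x) \<partial>M)"
  have I: "I \<ge> 0" unfolding I_def by auto
  have bound: "norm (\<integral>x. h x * of_real (g (T x)) \<partial>M) \<le> e * I" if e: "e > 0" for e
  proof -
    obtain p where p: "real_polynomial_function p" and close: "\<And>y. y \<in> S \<Longrightarrow> \<bar>g y - p y\<bar> < e"
      using Stone_Weierstrass_real_polynomial_function[OF S(2) g e] by blast
    have cp: "continuous_on S p"
      using continuous_on_polymonial_function p real_polynomial_function_eq by auto
    have "(\<integral>x. h x * of_real (g (T x)) \<partial>M) = (\<integral>x. h x * of_real (g (T x)) - h x * of_real (p (T x)) \<partial>M)"
      using poly[OF p] int[OF g] int[OF cp] by simp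
    also have "norm \<dots> \<le> (\<integral>x. e * norm (h x) \<partial>M)"
    proof (rule order_trans[OF integral_norm_bound integral_mono])
      show "integrable M (\<lambda>x. norm (h x * of_real (g (T x)) - h x * of_real (p (T x))))"
        using int[OF g] int[OF cp] by simp
      fix x assume "x \<in> space M"
      then have "\<bar>g (T x) - p (T x)\<bar> \<le> e" using close[OF S(1)] by force
      then have "norm (h x) * \<bar>g (T x) - p (T x)\<bar> \<le> norm (h x) * e"
        by (intro mult_left_mono) auto
      moreover have "norm (h x * of_real (g (T x)) - h x * of_real (p (T x))) = norm (h x) * \<bar>g (T x) - p (T x)\<bar>"
        unfolding right_diff_distrib[symmetric] of_real_diff[symmetric] norm_mult norm_of_real ..
      ultimately show "norm (h x * of_real (g (T x)) - h x * of_real (p (T x))) \<le> e * norm (h x)"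
        by (simp add: mult.commute)
    qed (use h in auto)
    finally show ?thesis by (simp add: I_def)
  qed
  have "norm (\<integral>x. h x * of_real (g (T x)) \<partial>M) \<le> 0 + e" if "e > 0" for e :: real
  proof -
    \<comment> \<open>The added 1 keeps the tolerance positive even when
      \<open>I = 0\<close>.\<close>
    have "norm (\<integral>x. h x * of_real (g (T x)) \<partial>M) \<le> e / (I + 1) * I"
      using I that by (intro bound) auto
    also have "\<dots> \<le> e" using I that by (simp add: field_simps)
    finally show ?thesis by simp
  qed
  then have "norm (\<integral>x. h x * of_real (g (T x)) \<partial>M) \<le> 0" by (rule field_le_epsilon)
  then show ?thesis by simp
qed

lemma integral_continuous_eq_0_of_powers:
  fixes h :: "'a \<Rightarrow> complex" and t g :: "_ \<Rightarrow> real"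
  assumes h: "integrable M h" and t: "t \<in> borel_measurable M"
    and t01: "\<And>x. x \<in> space M \<Longrightarrow> t x \<in> {0..1}"
    and moment: "\<And>k. (\<integral>x. h x * of_real (t x ^ k) \<partial>M) = 0"
    and g: "continuous_on {0..1} g"
  shows "(\<integral>x. h x * of_real (g (t x)) \<partial>M) = 0"
proof (rule integral_continuous_eq_0_of_polynomials[OF h t t01 _ _ g])
  fix p :: "real \<Rightarrow> real" assume "real_polynomial_function p"
  then obtain a n where p: "p = (\<lambda>x. \<Sum>i\<le>n. a i * x ^ i)"
    by (auto simp: real_polynomial_function_iff_sum)
  have int: "integrable M (\<lambda>x. h x * of_real (t x ^ k))" for k
    using t t01 by (intro integrable_mult_bounded[OF h, where B = 1])
      (auto simp: norm_power power_le_one)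
  have "(\<integral>x. h x * of_real (p (t x)) \<partial>M) = (\<integral>x. (\<Sum>i\<le>n. of_real (a i) * (h x * of_real (t x ^ i))) \<partial>M)"
    by (simp add: p sum_distrib_left mult_ac)
  also have "\<dots> = (\<Sum>i\<le>n. \<integral>x. of_real (a i) * (h x * of_real (t x ^ i)) \<partial>M)"
    using int by (intro Bochner_Integration.integral_sum) (auto simp del: of_real_power)
  also have "\<dots> = 0"
    using moment by (simp del: of_real_power)
  finally show "(\<integral>x. h x * of_real (p (t x)) \<partial>M) = 0" .
qed auto

text \<open>With \<open>u powr c\<close> absorbed into the density and \<open>u powr d\<close> as
  new variable, the hypothesis says that all integer moments vanish. The target is the power
  \<open>(y - c) / d\<close> of the new variable; \<open>y > c\<close> makes it continuous at 0,
  hence an admissible test function.\<close>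

lemma integral_powr_eq_0_of_progression:
  fixes h :: "'a \<Rightarrow> complex" and u :: "'a \<Rightarrow> real"
  assumes h: "integrable M h" and u: "u \<in> borel_measurable M"
    and u01: "\<And>x. x \<in> space M \<Longrightarrow> u x \<in> {0..1}"
    and d: "d > 0" and c: "c > 0"
    and moment: "\<And>k::nat. (\<integral>x. h x * of_real (u x powr (c + d * real k)) \<partial>M) = 0"
    and y: "y > c"
  shows "(\<integral>x. h x * of_real (u x powr y) \<partial>M) = 0"
proof -
  define H where "H = (\<lambda>x. h x * of_real (u x powr c))"
  have H: "integrable M H"
    unfolding H_def using u u01 c
    by (intro integrable_mult_bounded[OF h, where B = 1]) (auto simp: powr_le1)
  have "(\<integral>x. H x * of_real ((u x powr d) powr ((y - c) / d)) \<partial>M) = 0"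
  proof (rule integral_continuous_eq_0_of_powers[OF H, where g = "\<lambda>t. t powr ((y - c) / d)"])
    show "(\<lambda>x. u x powr d) \<in> borel_measurable M" using u by measurable
    show "u x powr d \<in> {0..1}" if "x \<in> space M" for x using u01[OF that] d by (auto simp: powr_le1)
    show "(\<integral>x. H x * of_real ((u x powr d) ^ k) \<partial>M) = 0" for k
    proof -
      have "H x * of_real ((u x powr d) ^ k) = h x * of_real (u x powr (c + d * real k))"
        if "x \<in> space M" for x
      proof -
        have "(u x powr d) ^ k = u x powr (d * real k)" if "u x \<noteq> 0"
          using that by (simp add: powr_power mult.commute)
        \<comment> \<open>Where \<open>u x = 0\<close>, the conventions \<open>0 ^ 0 = 1\<close> and
          \<open>0 powr 0 = 0\<close> disagree, but the factor \<open>u x powr c\<close> inside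
          \<open>H\<close> makes both sides vanish.\<close>
        then show ?thesis by (cases "u x = 0") (auto simp: H_def powr_add)
      qed
      then show ?thesis using moment[of k]
        by (subst Bochner_Integration.integral_cong[OF refl]) (auto simp del: of_real_power)
    qed
    show "continuous_on {0..1} (\<lambda>t::real. t powr ((y - c) / d))"
      using y d by (intro continuous_on_powr') (auto intro!: continuous_intros)
  qed
  moreover have "H x * of_real ((u x powr d) powr ((y - c) / d)) = h x * of_real (u x powr y)" for x
    using d by (simp add: H_def powr_powr mult.assoc flip: of_real_mult powr_add)
  ultimately show ?thesis by simp
qed

lemma integral_pair_mult:
  fixes f :: "'a \<Rightarrow> complex" and g :: "'b \<Rightarrow> complex"
  assumes M: "sigma_finite_measure M1" "sigma_finite_measure M2"
    and f: "integrable M1 f" and g: "integrable M2 g"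
  shows "integrable (M1 \<Otimes>\<^sub>M M2) (\<lambda>p. f (fst p) * g (snd p))"
    and "(\<integral>p. f (fst p) * g (snd p) \<partial>(M1 \<Otimes>\<^sub>M M2)) = (\<integral>x. f x \<partial>M1) * (\<integral>y. g y \<partial>M2)"
proof -
  interpret M1: sigma_finite_measure M1 by fact
  interpret M2: sigma_finite_measure M2 by fact
  interpret pair_sigma_finite M1 M2 ..
  have [measurable]: "f \<in> borel_measurable M1" "g \<in> borel_measurable M2" using f g by auto
  show int: "integrable (M1 \<Otimes>\<^sub>M M2) (\<lambda>p. f (fst p) * g (snd p))"
  proof (rule Fubini_integrable)
    show "integrable M1 (\<lambda>x. \<integral>y. norm (f (fst (x, y)) * g (snd (x, y))) \<partial>M2)"
      using f g by (simp add: norm_mult)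
    show "AE x in M1. integrable M2 (\<lambda>y. f (fst (x, y)) * g (snd (x, y)))"
      using g by simp
  qed measurable
  show "(\<integral>p. f (fst p) * g (snd p) \<partial>(M1 \<Otimes>\<^sub>M M2)) = (\<integral>x. f x \<partial>M1) * (\<integral>y. g y \<partial>M2)"
    using integral_fst'[OF int] by simp
qed

section \<open>Analytic dependence on the exponent, and zeros\<close>

text \<open>Differentiation under the integral sign. The derivative of the kernel contains
  \<open>ln u\<close>, unbounded near \<open>u = 0\<close>; a surplus power
  \<open>u powr \<delta>\<close> tames it, since
  \<open>\<bar>ln u\<bar> * u powr \<delta> \<le> 1 / \<delta>\<close>. This bound dominates all
  difference quotients near \<open>z0\<close>.\<close>

lemma holomorphic_integral_powr:
  fixes h :: "'a \<Rightarrow> complex" and u :: "'a \<Rightarrow> real"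
  assumes h: "integrable M h" and u: "u \<in> borel_measurable M"
    and u01: "\<And>x. x \<in> space M \<Longrightarrow> u x \<in> {0..1}"
  shows "(\<lambda>z. \<integral>x. h x * (of_real (u x) powr z) \<partial>M) holomorphic_on {z. Re z > 0}"
proof -
  define K where "K = (\<lambda>z x. complex_of_real (u x) powr z)"
  have nK: "norm (K z x) = u x powr Re z" if "x \<in> space M" for z x
    using u01[OF that] by (simp add: K_def norm_powr_real_powr)
  have mK [measurable]: "K z \<in> borel_measurable M" for z
    unfolding K_def using u by measurable
  have int: "integrable M (\<lambda>x. h x * K z x)" if "Re z > 0" for z
    using that u01 by (intro integrable_mult_bounded[OF h, where B = 1]) (auto simp: nK powr_le1)
  have "(\<lambda>z. \<integral>x. h x * K z x \<partial>M) field_differentiable at z0" if z0: "Re z0 > 0" for z0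
  proof -
    \<comment> \<open>Half the distance to the boundary line: the closed ball of radius
      \<open>\<delta>\<close> about \<open>z0\<close> then stays in
      \<open>Re z \<ge> \<delta>\<close>.\<close>
    define \<delta> where "\<delta> = Re z0 / 2"
    have \<delta>: "\<delta> > 0" using z0 by (simp add: \<delta>_def)
    define K' where "K' = (\<lambda>z x. ln (complex_of_real (u x)) * K z x)"
    have dK: "((\<lambda>z. K z x) has_field_derivative K' z x) (at z within A)" if "u x \<noteq> 0" for z x A
      unfolding K_def K'_def using that
      by (intro has_field_derivative_at_within[OF has_field_derivative_powr_right]) simp
    have bK': "norm (K' z x) \<le> 1 / \<delta>" if "Re z \<ge> \<delta>" and x: "x \<in> space M" and "u x \<noteq> 0" for z x
    proof -
      have ux: "0 < u x" "u x \<le> 1" using u01[OF x] that by auto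
      define q where "q = u x powr \<delta>"
      have q: "0 < q" "q \<le> 1" using ux \<delta> by (auto simp: q_def powr_le1)
      have "ln (1 / q) \<le> 1 / q" using q by (intro less_imp_le ln_less_self) auto
      then have "- ln q * q \<le> 1" using q by (simp add: ln_div field_simps)
      moreover have "- ln q = \<delta> * \<bar>ln (u x)\<bar>" using ux by (simp add: q_def ln_powr)
      ultimately have 1: "\<bar>ln (u x)\<bar> * q \<le> 1 / \<delta>" using \<delta> by (simp add: field_simps)
      have "norm (K' z x) = \<bar>ln (u x)\<bar> * u x powr Re z"
        using ux by (simp add: K'_def norm_mult nK[OF x] Ln_of_real)
      also have "\<dots> \<le> \<bar>ln (u x)\<bar> * q"
        using ux that by (intro mult_left_mono) (auto simp: q_def powr_mono')
      finally show ?thesis using 1 by simp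
    qed
    have lip: "norm (K (z0 + k) x - K z0 x) \<le> 1 / \<delta> * norm k"
      if k: "norm k \<le> \<delta>" and x: "x \<in> space M" for k x
    proof (cases "u x = 0")
      case True
      then show ?thesis using \<delta> by (simp add: K_def)
    next
      case False
      have "norm (K (z0 + k) x - K z0 x) \<le> 1 / \<delta> * norm (z0 + k - z0)"
      proof (rule field_differentiable_bound[where S = "cball z0 \<delta>"])
        fix z assume z: "z \<in> cball z0 \<delta>"
        have "\<bar>Re (z - z0)\<bar> \<le> \<delta>"
          using z abs_Re_le_cmod[of "z - z0"] by (simp add: dist_norm norm_minus_commute)
        then have "Re z \<ge> \<delta>" unfolding \<delta>_def minus_complex.sel by linarith
        then show "norm (K' z x) \<le> 1 / \<delta>" using bK' x False by blast
        show "((\<lambda>z. K z x) has_field_derivative K' z x) (at z within cball z0 \<delta>)"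
          by (rule dK[OF False])
      qed (use k \<delta> in \<open>auto simp: dist_norm\<close>)
      then show ?thesis by simp
    qed
    have "((\<lambda>z. \<integral>x. h x * K z x \<partial>M) has_field_derivative (\<integral>x. h x * K' z0 x \<partial>M)) (at z0)"
      unfolding DERIV_def tendsto_at_iff_sequentially
    proof (intro allI impI)
      fix X :: "nat \<Rightarrow> complex"
      assume X0: "\<forall>i. X i \<in> UNIV - {0}" and X: "X \<longlonglongrightarrow> 0"
      have "\<forall>\<^sub>F i in sequentially. norm (X i) < \<delta>"
        using X \<delta> by (auto dest!: tendstoD simp: dist_norm)
      then obtain N where N: "\<And>i. i \<ge> N \<Longrightarrow> norm (X i) < \<delta>"
        by (auto simp: eventually_sequentially)
      \<comment> \<open>Dropping the first N terms leaves only increments for which the Lipschitz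
        bound \<open>lip\<close> is available.\<close>
      define Y where "Y = (\<lambda>i. X (i + N))"
      have Y: "Y \<longlonglongrightarrow> 0" "\<And>i. Y i \<noteq> 0" "\<And>i. norm (Y i) < \<delta>"
        using X X0 N LIMSEQ_ignore_initial_segment by (auto simp: Y_def)
      have reY: "Re (z0 + Y i) > 0" for i
        using Y(3)[of i] abs_Re_le_cmod[of "Y i"] z0 by (simp add: \<delta>_def abs_le_iff)
      have lim: "(\<lambda>i. \<integral>x. h x * ((K (z0 + Y i) x - K z0 x) / Y i) \<partial>M) \<longlonglongrightarrow> (\<integral>x. h x * K' z0 x \<partial>M)"
      proof (rule integral_dominated_convergence[where w = "\<lambda>x. norm (h x) * (1 / \<delta>)"])
        show "(\<lambda>x. h x * K' z0 x) \<in> borel_measurable M"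
          unfolding K'_def using h u by measurable
        show "(\<lambda>x. h x * ((K (z0 + Y i) x - K z0 x) / Y i)) \<in> borel_measurable M" for i
          using h by measurable
        show "integrable M (\<lambda>x. norm (h x) * (1 / \<delta>))" using h by auto
        show "AE x in M. norm (h x * ((K (z0 + Y i) x - K z0 x) / Y i)) \<le> norm (h x) * (1 / \<delta>)" for i
        proof (rule AE_I2)
          fix x assume x: "x \<in> space M"
          have "norm ((K (z0 + Y i) x - K z0 x) / Y i) \<le> 1 / \<delta>"
            using lip[of "Y i" x] Y(2,3)[of i] x by (simp add: norm_divide field_simps)
          then show "norm (h x * ((K (z0 + Y i) x - K z0 x) / Y i)) \<le> norm (h x) * (1 / \<delta>)"
            unfolding norm_mult by (rule mult_left_mono) auto
        qed
        show "AE x in M. (\<lambda>i. h x * ((K (z0 + Y i) x - K z0 x) / Y i)) \<longlonglongrightarrow> h x * K' z0 x"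
        proof (rule AE_I2)
          fix x assume x: "x \<in> space M"
          have "(\<lambda>i. (K (z0 + Y i) x - K z0 x) / Y i) \<longlonglongrightarrow> K' z0 x"
          proof (cases "u x = 0")
            case False
            from dK[OF this, of z0 UNIV] have "((\<lambda>k. (K (z0 + k) x - K z0 x) / k) \<longlongrightarrow> K' z0 x) (at 0)"
              by (simp add: DERIV_def)
            then show ?thesis
              unfolding tendsto_at_iff_sequentially using Y by (auto simp: o_def)
          qed (simp add: K_def K'_def)
          then show "(\<lambda>i. h x * ((K (z0 + Y i) x - K z0 x) / Y i)) \<longlonglongrightarrow> h x * K' z0 x"
            by (rule tendsto_mult_left)
        qed
      qed
      have eq: "(\<integral>x. h x * ((K (z0 + Y i) x - K z0 x) / Y i) \<partial>M)
          = ((\<integral>x. h x * K (z0 + Y i) x \<partial>M) - (\<integral>x. h x * K z0 x \<partial>M)) / Y i" for i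
      proof -
        have "(\<integral>x. h x * ((K (z0 + Y i) x - K z0 x) / Y i) \<partial>M)
           = (\<integral>x. (h x * K (z0 + Y i) x - h x * K z0 x) / Y i \<partial>M)"
          by (simp add: right_diff_distrib diff_divide_distrib)
        then show ?thesis using int[OF reY[of i]] int[OF z0] by simp
      qed
      have "(\<lambda>i. ((\<integral>x. h x * K (z0 + Y i) x \<partial>M) - (\<integral>x. h x * K z0 x \<partial>M)) / Y i)
          \<longlonglongrightarrow> (\<integral>x. h x * K' z0 x \<partial>M)" 
        using lim unfolding eq .
      then show "((\<lambda>k. ((\<integral>x. h x * K (z0 + k) x \<partial>M) - (\<integral>x. h x * K z0 x \<partial>M)) / k) \<circ> X)
          \<longlonglongrightarrow> (\<integral>x. h x * K' z0 x \<partial>M)"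
        unfolding Y_def o_def by (rule LIMSEQ_offset[where k = N])
    qed
    then show ?thesis unfolding field_differentiable_def by blast
  qed
  then show ?thesis
    unfolding K_def by (auto simp: holomorphic_on_def intro: field_differentiable_at_within)
qed

text \<open>An analytic function on a half-plane that is not identically zero has only countably
  many zeros; the real zeros of \<open>F\<close> are among them.\<close>

lemma integral_powr_zeros:
  fixes h :: "'a \<Rightarrow> complex" and u :: "'a \<Rightarrow> real"
  assumes h: "integrable M h" and u: "u \<in> borel_measurable M"
    and u01: "\<And>x. x \<in> space M \<Longrightarrow> u x \<in> {0..1}"
  defines "F \<equiv> \<lambda>y::real. \<integral>x. h x * of_real (u x powr y) \<partial>M"
  shows "countable {y. y > 0 \<and> F y = 0} \<or> (\<forall>y>0. F y = 0)"
proof (rule disjCI)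
  assume nz: "\<not> (\<forall>y>0. F y = 0)"
  define G where "G = (\<lambda>z. \<integral>x. h x * (of_real (u x) powr z) \<partial>M)"
  have GF: "G (of_real y) = F y" for y
    unfolding G_def F_def using u01 by (intro Bochner_Integration.integral_cong) (auto simp: powr_of_real)
  define S where "S = {z. Re z > 0}"
  have "convex S" unfolding S_def by (rule convex_halfspace_Re_gt)
  have "open S" unfolding S_def by (rule open_halfspace_Re_gt)
  \<comment> \<open>The identity theorem for uncountable coincidence sets is stated for F-sigma
    domains; closed half-planes exhaust the open one.\<close>
  have "S = (\<Union>n::nat. {z. inverse (Suc n) \<le> Re z})"
  proof
    show "S \<subseteq> (\<Union>n::nat. {z. inverse (Suc n) \<le> Re z})"
    proof
      fix z assume "z \<in> S"
      then obtain n :: nat where "inverse (real (Suc n)) < Re z"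
        using reals_Archimedean[of "Re z"] by (auto simp: S_def)
      then show "z \<in> (\<Union>n::nat. {z. inverse (Suc n) \<le> Re z})"
        by (intro UN_I[of n]) auto
    qed
    show "(\<Union>n::nat. {z. inverse (Suc n) \<le> Re z}) \<subseteq> S"
    proof
      fix z assume "z \<in> (\<Union>n::nat. {z. inverse (Suc n) \<le> Re z})"
      then obtain n :: nat where n: "inverse (real (Suc n)) \<le> Re z" by blast
      have "0 < inverse (real (Suc n))" by simp
      with n show "z \<in> S" unfolding S_def mem_Collect_eq by linarith
    qed
  qed
  moreover have "fsigma (\<Union>n::nat. {z. inverse (Suc n) \<le> Re z})"
    by (intro fsigma.intros) (auto intro: closed_halfspace_Re_ge)
  ultimately have "fsigma S" by simp
  have "countable {z \<in> S. G z = 0}"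
  proof (rule ccontr)
    assume "uncountable {z \<in> S. G z = 0}"
    then have "S \<subseteq> {z \<in> S. G z = 0}"
      using holomorphic_integral_powr[OF h u u01] \<open>convex S\<close> \<open>open S\<close> \<open>fsigma S\<close>
      by (intro holomorphic_countable_equal) (auto simp: G_def S_def convex_connected)
    then have "F y = 0" if "y > 0" for y
    proof -
      have "complex_of_real y \<in> S" using that by (simp add: S_def)
      then have "G (complex_of_real y) = 0"
        using \<open>S \<subseteq> {z \<in> S. G z = 0}\<close> by blast
      then show ?thesis by (simp only: GF)
    qed
    with nz show False by blast
  qed
  moreover have "of_real ` {y. y > 0 \<and> F y = 0} \<subseteq> {z \<in> S. G z = 0}"
    using GF by (auto simp: S_def)
  ultimately have "countable (complex_of_real ` {y. y > 0 \<and> F y = 0})"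
    using countable_subset by blast
  then show "countable {y. y > 0 \<and> F y = 0}"
    by (rule countable_image_inj_on) (auto simp: inj_on_def)
qed

section \<open>Radial functions are determined by their moments\<close>

text \<open>These are the complex polynomials in x and y, written in a basis whose elements have a
  definite angular degree \<open>a - b\<close>.\<close>

inductive bipolynomial :: "(complex \<Rightarrow> complex) \<Rightarrow> bool" where
  monomial: "bipolynomial (\<lambda>z. z ^ a * cnj z ^ b)"
| scale: "bipolynomial f \<Longrightarrow> bipolynomial (\<lambda>z. c * f z)"
| add: "bipolynomial f \<Longrightarrow> bipolynomial g \<Longrightarrow> bipolynomial (\<lambda>z. f z + g z)"

lemma bipolynomial_mult_linear:
  assumes "bipolynomial f"
  shows "bipolynomial (\<lambda>z. (\<alpha> * z + \<beta> * cnj z) * f z)"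
  using assms
proof induction
  case (monomial a b)
  have "bipolynomial (\<lambda>z. \<alpha> * (z ^ Suc a * cnj z ^ b) + \<beta> * (z ^ a * cnj z ^ Suc b))"
    by (intro bipolynomial.intros)
  then show ?case by (simp add: algebra_simps)
next
  case (scale f c)
  from bipolynomial.scale[OF scale.IH, of c] show ?case by (simp add: algebra_simps)
next
  case (add f g)
  from bipolynomial.add[OF add.IH] show ?case by (simp add: algebra_simps)
qed

text \<open>The change from x, y to \<open>z\<close>, \<open>cnj z\<close>. Phrasing it as
  multiplication of an arbitrary \<open>f\<close> makes the product case of the induction a
  composition of the two induction hypotheses.\<close>

lemma bipolynomial_mult_real_polynomial:
  assumes "real_polynomial_function p" "bipolynomial f"
  shows "bipolynomial (\<lambda>z. of_real (p z) * f z)"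
  using assms
proof (induction arbitrary: f)
  case (linear p)
  \<comment> \<open>From \<open>x = (z + cnj z) / 2\<close> and
    \<open>y = (z - cnj z) / (2 * \<i>)\<close>, inserted into the linear form
    \<open>x * p 1 + y * p \<i>\<close>.\<close>
  define \<alpha> where "\<alpha> = (of_real (p 1) - \<i> * of_real (p \<i>)) / (2::complex)"
  define \<beta> where "\<beta> = (of_real (p 1) + \<i> * of_real (p \<i>)) / (2::complex)"
  have "complex_of_real (p z) = \<alpha> * z + \<beta> * cnj z" for z
  proof -
    have "z = Re z *\<^sub>R 1 + Im z *\<^sub>R \<i>"
      by (simp add: complex_eq_iff)
    then have "p z = p (Re z *\<^sub>R 1 + Im z *\<^sub>R \<i>)" by (rule arg_cong)
    also have "\<dots> = Re z * p 1 + Im z * p \<i>"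
      using linear(1) by (simp add: linear_simps bounded_linear.linear)
    finally show ?thesis by (simp add: \<alpha>_def \<beta>_def complex_eq_iff field_simps)
  qed
  then show ?case using bipolynomial_mult_linear[OF linear(2)] by (simp only:)
next
  case (const c)
  then show ?case by (rule bipolynomial.scale)
next
  case (add p q)
  from bipolynomial.add[OF add.IH(1)[OF add.prems] add.IH(2)[OF add.prems]]
  show ?case by (simp add: algebra_simps)
next
  case (mult p q)
  from mult.IH(1)[OF mult.IH(2)[OF mult.prems]] show ?case by (simp add: mult.assoc)
qed

lemma integrable_dA_mult_continuous:
  fixes F g :: "complex \<Rightarrow> complex"
  assumes F: "integrable dA F" and g: "continuous_on (cball 0 1) g"
  shows "integrable dA (\<lambda>z. F z * g z)"
proof -
  have "bounded (g ` cball 0 1)"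
    using g by (intro compact_imp_bounded compact_continuous_image) simp_all
  then obtain B where "\<forall>z\<in>cball 0 1. norm (g z) \<le> B"
    unfolding bounded_iff by blast
  moreover have "g \<in> borel_measurable dA"
    using continuous_on_subset[OF g ball_subset_cball] by (rule borel_measurable_dA_continuous_on)
  ultimately show ?thesis
    by (intro integrable_mult_bounded[OF F, where B = B]) auto
qed

text \<open>It is enough that \<open>F\<close> integrates to zero over every measurable set, and
  indicators are almost everywhere limits of continuous functions.\<close>

lemma AE_dA_eq_0_of_continuous:
  fixes F :: "complex \<Rightarrow> complex"
  assumes F: "integrable dA F"
    and c: "\<And>g :: complex \<Rightarrow> real. continuous_on UNIV g \<Longrightarrow> (\<integral>z. F z * of_real (g z) \<partial>dA) = 0"
  shows "AE z in dA. F z = 0"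
proof (rule dA.density_zero[OF F])
  fix A assume "A \<in> sets dA"
  then have A: "A \<in> sets lebesgue" "A \<subseteq> disk"
    by (auto simp: sets_dA sets_restrict_space_iff)
  have "(indicator A :: complex \<Rightarrow> real) \<in> borel_measurable (lebesgue_on UNIV)"
    using A by simp
  then have "(indicator A :: complex \<Rightarrow> real) measurable_on UNIV"
    by (simp add: measurable_on_iff_borel_measurable)
  then obtain N g where N: "negligible N" and g: "\<And>n. continuous_on UNIV (g n)"
    and lim: "\<And>x. x \<notin> N \<Longrightarrow> (\<lambda>n. g n x) \<longlonglongrightarrow> (indicator A x :: real)"
    unfolding measurable_on_def by auto
  \<comment> \<open>Clipping to [0,1] preserves the limit, which is 0 or 1, and gives the dominating
    function \<open>norm (F z)\<close>.\<close>
  define G where "G = (\<lambda>n x. max 0 (min 1 (g n x)))"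
  have G: "continuous_on UNIV (G n)" for n
    unfolding G_def using g by (intro continuous_intros)
  have mG: "(\<lambda>z. complex_of_real (G n z)) \<in> borel_measurable dA" for n
    by (intro borel_measurable_dA_continuous_on continuous_intros continuous_on_subset[OF G]) auto
  have limG: "(\<lambda>n. G n x) \<longlonglongrightarrow> indicator A x" if "x \<notin> N" for x
  proof -
    have "(\<lambda>n. G n x) \<longlonglongrightarrow> max 0 (min 1 (indicator A x))"
      unfolding G_def using lim[OF that] by (intro tendsto_intros)
    then show ?thesis by (simp add: indicator_def split: if_splits)
  qed
  have AE_N: "AE z in dA. z \<notin> N"
    unfolding AE_dA_iff using N by (auto simp: negligible_iff_null_sets dest: AE_not_in)
  have "(\<lambda>n. \<integral>z. F z * of_real (G n z) \<partial>dA) \<longlonglongrightarrow> (\<integral>z. F z * of_real (indicator A z) \<partial>dA)"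
  proof (rule integral_dominated_convergence[where w = "\<lambda>z. norm (F z)"])
    show "(\<lambda>z. F z * complex_of_real (indicator A z)) \<in> borel_measurable dA"
      using F \<open>A \<in> sets dA\<close> by measurable
    show "(\<lambda>z. F z * complex_of_real (G n z)) \<in> borel_measurable dA" for n
      using F mG by measurable
    show "AE z in dA. (\<lambda>n. F z * complex_of_real (G n z)) \<longlonglongrightarrow> F z * complex_of_real (indicator A z)"
      using AE_N by eventually_elim (intro tendsto_intros limG)
    show "AE z in dA. norm (F z * complex_of_real (G n z)) \<le> norm (F z)" for n
      by (auto simp: G_def norm_mult intro!: mult_left_le)
  qed (use F in auto)
  then have "(\<integral>z. F z * of_real (indicator A z) \<partial>dA) = 0"
    using c[OF G] by (simp add: LIMSEQ_const_iff)
  then show "set_lebesgue_integral dA A F = 0"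
    by (simp add: set_lebesgue_integral_def scaleR_conv_of_real mult.commute)
qed

text \<open>Tested against \<open>z ^ a * cnj z ^ b\<close>, the diagonal terms \<open>a = b\<close>
  vanish by the moment hypothesis and all others by angular degree. Linear combinations of these
  functions are uniformly dense on the closed disk.\<close>

lemma AE_dA_eq_0_of_radial_moments:
  fixes F :: "complex \<Rightarrow> complex"
  assumes F: "integrable dA F"
    and rot: "\<And>w z. cmod w = 1 \<Longrightarrow> z \<in> disk - {0} \<Longrightarrow> F (w * z) = F z"
    and moment: "\<And>k::nat. (\<integral>z. F z * of_real (cmod z ^ (2 * k)) \<partial>dA) = 0"
  shows "AE z in dA. F z = 0"
proof (rule AE_dA_eq_0_of_continuous[OF F])
  fix g :: "complex \<Rightarrow> real" assume g: "continuous_on UNIV g"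
  have mono: "(\<integral>z. F z * (z ^ a * cnj z ^ b) \<partial>dA) = 0" for a b
  proof (cases "a = b")
    case True
    have "z ^ a * cnj z ^ a = of_real (cmod z ^ (2 * a))" for z
      by (metis complex_norm_square of_real_power power_mult power_mult_distrib)
    with True moment show ?thesis by simp
  next
    case False
    show ?thesis
    proof (rule integral_dA_eq_0_of_angular_degree[where k = "int a - int b"])
      show "(\<lambda>z. F z * (z ^ a * cnj z ^ b)) \<in> borel_measurable dA"
        by (intro borel_measurable_integrable integrable_dA_mult_continuous[OF F] continuous_intros)
      fix w z :: complex assume w: "cmod w = 1" and z: "z \<in> disk - {0}"
      have "w \<noteq> 0" using w by auto
      then have "cnj w = inverse w"
        using w by (simp add: complex_norm_square[symmetric] inverse_complex_def complex_eq_iff cmod_def)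
      then have "w powi (int a - int b) = w ^ a * cnj w ^ b"
        using \<open>w \<noteq> 0\<close> by (simp add: power_int_diff divide_inverse power_inverse)
      then show "F (w * z) * ((w * z) ^ a * cnj (w * z) ^ b) = w powi (int a - int b) * (F z * (z ^ a * cnj z ^ b))"
        using rot[OF w z] by (simp add: power_mult_distrib)
    qed (use False in auto)
  qed
  have bip: "continuous_on UNIV f \<and> (\<integral>z. F z * f z \<partial>dA) = 0" if "bipolynomial f" for f
    using that
  proof induction
    case (monomial a b)
    then show ?case using mono by (auto intro!: continuous_intros)
  next
    case (scale f c)
    then show ?case by (auto intro!: continuous_intros simp: mult.left_commute)
  next
    case (add f g)
    then have "integrable dA (\<lambda>z. F z * f z)" "integrable dA (\<lambda>z. F z * g z)"
      by (auto intro!: integrable_dA_mult_continuous[OF F] intro: continuous_on_subset)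
    with add show ?case by (auto intro!: continuous_intros simp: distrib_left)
  qed
  show "(\<integral>z. F z * of_real (g z) \<partial>dA) = 0"
  proof (rule integral_continuous_eq_0_of_polynomials[OF F, where S = "cball 0 1" and T = "\<lambda>z. z"])
    show "(\<lambda>z. z) \<in> borel_measurable dA"
      by (intro borel_measurable_dA_continuous_on continuous_intros)
    fix p :: "complex \<Rightarrow> real" assume "real_polynomial_function p"
    from bip[OF bipolynomial_mult_real_polynomial[OF this bipolynomial.monomial[of 0 0]]]
    show "(\<integral>z. F z * of_real (p z) \<partial>dA) = 0" by simp
  qed (use g in \<open>auto intro: continuous_on_subset\<close>)
qed

section \<open>Harmonic functions on the disk\<close>

text \<open>The second difference is symmetric in \<open>a\<close> and \<open>b\<close>, whereas the
  mean value theorem applied first along \<open>a\<close> and then along \<open>b\<close> yields one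
  particular mixed partial. Exchanging the roles yields the other, as in the classical proof of
  Schwarz's theorem.\<close>

lemma double_difference_mvt:
  fixes f g k :: "complex \<Rightarrow> real"
  assumes h: "h > 0"
    and fg: "\<And>s t. s \<in> {0..h} \<Longrightarrow> t \<in> {0..h} \<Longrightarrow>
      ((\<lambda>s. f (z + of_real s * a + of_real t * b)) has_real_derivative g (z + of_real s * a + of_real t * b)) (at s)"
    and gk: "\<And>s t. s \<in> {0..h} \<Longrightarrow> t \<in> {0..h} \<Longrightarrow>
      ((\<lambda>t. g (z + of_real s * a + of_real t * b)) has_real_derivative k (z + of_real s * a + of_real t * b)) (at t)"
  obtains s t where "s \<in> {0..h}" "t \<in> {0..h}"
    "f (z + of_real h * a + of_real h * b) - f (z + of_real h * a) - f (z + of_real h * b) + f z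
      = h * h * k (z + of_real s * a + of_real t * b)"
proof -
  define F where "F = (\<lambda>s. f (z + of_real s * a + of_real h * b) - f (z + of_real s * a + of_real 0 * b))"
  have "\<exists>s>0. s < h \<and> F h - F 0 = (h - 0) * (g (z + of_real s * a + of_real h * b) - g (z + of_real s * a + of_real 0 * b))"
    unfolding F_def by (rule MVT2[OF h]) (intro DERIV_diff fg; use h in simp)
  then obtain s where s: "0 < s" "s < h"
    "F h - F 0 = h * (g (z + of_real s * a + of_real h * b) - g (z + of_real s * a + of_real 0 * b))"
    by auto
  have "\<exists>t>0. t < h \<and> g (z + of_real s * a + of_real h * b) - g (z + of_real s * a + of_real 0 * b)
      = (h - 0) * k (z + of_real s * a + of_real t * b)"
    by (rule MVT2[OF h]) (intro gk; use s in simp)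
  then obtain t where t: "0 < t" "t < h"
    "g (z + of_real s * a + of_real h * b) - g (z + of_real s * a + of_real 0 * b)
      = h * k (z + of_real s * a + of_real t * b)"
    by auto
  show thesis
  proof (rule that)
    show "f (z + of_real h * a + of_real h * b) - f (z + of_real h * a) - f (z + of_real h * b) + f z
      = h * h * k (z + of_real s * a + of_real t * b)"
      using s(3) t(3) by (simp add: F_def)
  qed (use s t in auto)
qed

lemma has_real_derivative_partial:
  fixes u ux uy :: "complex \<Rightarrow> real"
  assumes "(u has_derivative (\<lambda>h. Re h * ux (z + of_real s * a + of_real t * b) + Im h * uy (z + of_real s * a + of_real t * b)))
     (at (z + of_real s * a + of_real t * b))"
  shows "((\<lambda>s. u (z + of_real s * a + of_real t * b)) has_real_derivative
      Re a * ux (z + of_real s * a + of_real t * b) + Im a * uy (z + of_real s * a + of_real t * b)) (at s)"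
    and "((\<lambda>t. u (z + of_real s * a + of_real t * b)) has_real_derivative
      Re b * ux (z + of_real s * a + of_real t * b) + Im b * uy (z + of_real s * a + of_real t * b)) (at t)"
proof -
  have 1: "((\<lambda>s. z + of_real s * a + of_real t * b) has_derivative (\<lambda>h. of_real h * a)) (at s)"
    by (auto intro!: derivative_eq_intros)
  have 2: "((\<lambda>t. z + of_real s * a + of_real t * b) has_derivative (\<lambda>h. of_real h * b)) (at t)"
    by (auto intro!: derivative_eq_intros)
  show "((\<lambda>s. u (z + of_real s * a + of_real t * b)) has_real_derivative
      Re a * ux (z + of_real s * a + of_real t * b) + Im a * uy (z + of_real s * a + of_real t * b)) (at s)"
    using has_derivative_compose[OF 1 assms]
    unfolding has_field_derivative_def by (rule has_derivative_eq_rhs) (auto simp: algebra_simps)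
  show "((\<lambda>t. u (z + of_real s * a + of_real t * b)) has_real_derivative
      Re b * ux (z + of_real s * a + of_real t * b) + Im b * uy (z + of_real s * a + of_real t * b)) (at t)"
    using has_derivative_compose[OF 2 assms]
    unfolding has_field_derivative_def by (rule has_derivative_eq_rhs) (auto simp: algebra_simps)
qed

text \<open>The definition of \<open>harmonic_on\<close> does not impose symmetry of the mixed
  partials on its witnesses, so it is derived. Both orders describe the same \<open>D n\<close>;
  after division by \<open>h n * h n\<close>, continuity at \<open>z\<close> identifies the
  limits.\<close>

lemma mixed_partials_eq_real:
  fixes u ux uy uxx uxy uyx uyy :: "complex \<Rightarrow> real"
  assumes S: "open S" "z \<in> S"
    and u: "\<And>z. z \<in> S \<Longrightarrow> (u has_derivative (\<lambda>h. Re h * ux z + Im h * uy z)) (at z)"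
    and ux: "\<And>z. z \<in> S \<Longrightarrow> (ux has_derivative (\<lambda>h. Re h * uxx z + Im h * uxy z)) (at z)"
    and uy: "\<And>z. z \<in> S \<Longrightarrow> (uy has_derivative (\<lambda>h. Re h * uyx z + Im h * uyy z)) (at z)"
    and cont: "continuous_on S uxy" "continuous_on S uyx"
  shows "uxy z = uyx z"
proof -
  obtain r where r: "r > 0" "ball z r \<subseteq> S"
    using S open_contains_ball by blast
  \<comment> \<open>A third of the radius, because the sample points lie within
    \<open>2 * h n\<close> of \<open>z\<close> and must stay in the ball.\<close>
  define h where "h = (\<lambda>n::nat. r / 3 * inverse (Suc n))"
  have h0: "h n > 0" for n using r by (simp add: h_def)
  have hr: "2 * h n < r" for n
  proof -
    have "inverse (real (Suc n)) \<le> 1" by (simp add: field_simps)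
    then have "h n \<le> r / 3 * 1" unfolding h_def using r by (intro mult_left_mono) auto
    then show ?thesis using r by simp
  qed
  have hlim: "(\<lambda>n. 2 * h n) \<longlonglongrightarrow> 0"
    unfolding h_def by (rule tendsto_eq_intros LIMSEQ_inverse_real_of_nat refl | simp)+
  have near: "cmod (of_real s * a + of_real t * b) \<le> 2 * h n"
    if "s \<in> {0..h n}" "t \<in> {0..h n}" "cmod a = 1" "cmod b = 1" for s t n a b
    using norm_triangle_ineq[of "of_real s * a" "of_real t * b"] that by (simp add: norm_mult)
  have inS: "z + of_real s * a + of_real t * b \<in> S"
    if "s \<in> {0..h n}" "t \<in> {0..h n}" "cmod a = 1" "cmod b = 1" for s t n a b
  proof -
    have "dist (z + of_real s * a + of_real t * b) z < r"
      using near[OF that] hr[of n] by (simp add: dist_norm add.assoc)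
    then show ?thesis using r(2) by (auto simp: dist_commute)
  qed
  have lim: "(\<lambda>n. k (\<zeta> n)) \<longlonglongrightarrow> k z"
    if k: "continuous_on S k" and \<zeta>: "\<And>n. cmod (\<zeta> n - z) \<le> 2 * h n" "\<And>n. \<zeta> n \<in> S" for k :: "complex \<Rightarrow> real" and \<zeta>
  proof -
    have "(\<lambda>n. \<zeta> n - z) \<longlonglongrightarrow> 0"
      using \<zeta>(1) hlim by (intro Lim_null_comparison[of "\<lambda>n. \<zeta> n - z" "\<lambda>n. 2 * h n"]) auto
    then have "\<zeta> \<longlonglongrightarrow> z" by (rule LIM_zero_cancel)
    then show ?thesis
      using continuous_on_tendsto_compose[OF k, of \<zeta> z sequentially] S \<zeta>(2) by auto
  qed
  define D where "D = (\<lambda>n. u (z + of_real (h n) + \<i> * of_real (h n)) - u (z + of_real (h n)) - u (z + \<i> * of_real (h n)) + u z)"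
  have "\<exists>\<zeta>. \<zeta> \<in> S \<and> cmod (\<zeta> - z) \<le> 2 * h n \<and> D n = h n * h n * uxy \<zeta>" for n
  proof -
    obtain s t where st: "s \<in> {0..h n}" "t \<in> {0..h n}"
      "u (z + of_real (h n) * 1 + of_real (h n) * \<i>) - u (z + of_real (h n) * 1) - u (z + of_real (h n) * \<i>) + u z
        = h n * h n * uxy (z + of_real s * 1 + of_real t * \<i>)"
    proof (rule double_difference_mvt[OF h0[of n], where f = u and g = ux and k = uxy and z = z and a = 1 and b = \<i>])
      fix s t assume st: "s \<in> {0..h n}" "t \<in> {0..h n}"
      note i = inS[OF st, of 1 \<i>, OF norm_one norm_ii]
      show "((\<lambda>s. u (z + of_real s * 1 + of_real t * \<i>)) has_real_derivative ux (z + of_real s * 1 + of_real t * \<i>)) (at s)"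
        using has_real_derivative_partial(1)[where u = u and ux = ux and uy = uy, OF u[OF i]] by simp
      show "((\<lambda>t. ux (z + of_real s * 1 + of_real t * \<i>)) has_real_derivative uxy (z + of_real s * 1 + of_real t * \<i>)) (at t)"
        using has_real_derivative_partial(2)[where u = ux and ux = uxx and uy = uxy, OF ux[OF i]] by simp
    qed auto
    then show ?thesis
      using inS[OF st(1,2), of 1 \<i>] near[OF st(1,2), of 1 \<i>]
      by (intro exI[of _ "z + of_real s * 1 + of_real t * \<i>"]) (simp add: D_def mult.commute add.assoc)
  qed
  then obtain \<xi> where \<xi>: "\<And>n. \<xi> n \<in> S" "\<And>n. cmod (\<xi> n - z) \<le> 2 * h n" "\<And>n. D n = h n * h n * uxy (\<xi> n)"
    by metis
  have "\<exists>\<zeta>. \<zeta> \<in> S \<and> cmod (\<zeta> - z) \<le> 2 * h n \<and> D n = h n * h n * uyx \<zeta>" for n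
  proof -
    obtain s t where st: "s \<in> {0..h n}" "t \<in> {0..h n}"
      "u (z + of_real (h n) * \<i> + of_real (h n) * 1) - u (z + of_real (h n) * \<i>) - u (z + of_real (h n) * 1) + u z
        = h n * h n * uyx (z + of_real s * \<i> + of_real t * 1)"
    proof (rule double_difference_mvt[OF h0[of n], where f = u and g = uy and k = uyx and z = z and a = \<i> and b = 1])
      fix s t assume st: "s \<in> {0..h n}" "t \<in> {0..h n}"
      note i = inS[OF st, of \<i> 1, OF norm_ii norm_one]
      show "((\<lambda>s. u (z + of_real s * \<i> + of_real t * 1)) has_real_derivative uy (z + of_real s * \<i> + of_real t * 1)) (at s)"
        using has_real_derivative_partial(1)[where u = u and ux = ux and uy = uy, OF u[OF i]] by simp
      show "((\<lambda>t. uy (z + of_real s * \<i> + of_real t * 1)) has_real_derivative uyx (z + of_real s * \<i> + of_real t * 1)) (at t)"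
        using has_real_derivative_partial(2)[where u = uy and ux = uyx and uy = uyy, OF uy[OF i]] by simp
    qed auto
    then show ?thesis
      using inS[OF st(1,2), of \<i> 1] near[OF st(1,2), of \<i> 1]
      by (intro exI[of _ "z + of_real s * \<i> + of_real t * 1"]) (simp add: D_def mult.commute add_ac)
  qed
  then obtain \<eta> where \<eta>: "\<And>n. \<eta> n \<in> S" "\<And>n. cmod (\<eta> n - z) \<le> 2 * h n" "\<And>n. D n = h n * h n * uyx (\<eta> n)"
    by metis
  have "uxy (\<xi> n) = uyx (\<eta> n)" for n
    using \<xi>(3)[of n] \<eta>(3)[of n] h0[of n] by simp
  then have "(\<lambda>n. uxy (\<xi> n)) \<longlonglongrightarrow> uyx z"
    using lim[OF cont(2) \<eta>(2,1)] by simp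
  then show ?thesis
    using lim[OF cont(1) \<xi>(2,1)] LIMSEQ_unique by blast
qed

lemma mixed_partials_eq:
  fixes u ux uy uxx uxy uyx uyy :: "complex \<Rightarrow> complex"
  assumes S: "open S" "z \<in> S"
    and u: "\<And>z. z \<in> S \<Longrightarrow> (u has_derivative (\<lambda>h. Re h *\<^sub>R ux z + Im h *\<^sub>R uy z)) (at z)"
    and ux: "\<And>z. z \<in> S \<Longrightarrow> (ux has_derivative (\<lambda>h. Re h *\<^sub>R uxx z + Im h *\<^sub>R uxy z)) (at z)"
    and uy: "\<And>z. z \<in> S \<Longrightarrow> (uy has_derivative (\<lambda>h. Re h *\<^sub>R uyx z + Im h *\<^sub>R uyy z)) (at z)"
    and cont: "continuous_on S uxy" "continuous_on S uyx"
  shows "uxy z = uyx z"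
proof -
  have re: "((\<lambda>z. Re (f z)) has_derivative (\<lambda>h. Re h * Re a + Im h * Re b)) (at z)"
    and im: "((\<lambda>z. Im (f z)) has_derivative (\<lambda>h. Re h * Im a + Im h * Im b)) (at z)"
    if "(f has_derivative (\<lambda>h. Re h *\<^sub>R a + Im h *\<^sub>R b)) (at z)" for f :: "complex \<Rightarrow> complex" and a b z
    using bounded_linear.has_derivative[OF bounded_linear_Re that] bounded_linear.has_derivative[OF bounded_linear_Im that]
    by simp_all
  show ?thesis
  proof (rule complex_eqI)
    show "Re (uxy z) = Re (uyx z)"
      by (rule mixed_partials_eq_real[OF S re[OF u] re[OF ux] re[OF uy]]) (assumption | intro continuous_intros cont)+
    show "Im (uxy z) = Im (uyx z)"
      by (rule mixed_partials_eq_real[OF S im[OF u] im[OF ux] im[OF uy]]) (assumption | intro continuous_intros cont)+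
  qed
qed

text \<open>\<open>ux - \<i> uy\<close> is holomorphic; half its primitive is the holomorphic part.\<close>

lemma harmonic_on_decomposition:
  assumes S: "open S" "convex S" and "harmonic_on S u"
  obtains f g where "f holomorphic_on S" "g holomorphic_on S" "\<And>z. z \<in> S \<Longrightarrow> u z = f z + cnj (g z)"
proof -
  obtain ux uy uxx uxy uyx uyy where
    u: "\<And>z. z \<in> S \<Longrightarrow> (u has_derivative (\<lambda>h. Re h *\<^sub>R ux z + Im h *\<^sub>R uy z)) (at z)"
    and ux: "\<And>z. z \<in> S \<Longrightarrow> (ux has_derivative (\<lambda>h. Re h *\<^sub>R uxx z + Im h *\<^sub>R uxy z)) (at z)"
    and uy: "\<And>z. z \<in> S \<Longrightarrow> (uy has_derivative (\<lambda>h. Re h *\<^sub>R uyx z + Im h *\<^sub>R uyy z)) (at z)"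
    and cont: "continuous_on S uxy" "continuous_on S uyx"
    and lap: "\<And>z. z \<in> S \<Longrightarrow> uxx z + uyy z = 0"
    using assms(3) unfolding harmonic_on_def by blast
  define F where "F = (\<lambda>z. (ux z - \<i> * uy z) / 2)"
  have "(F has_field_derivative (uxx z - \<i> * uyx z) / 2) (at z)" if z: "z \<in> S" for z
  proof -
    \<comment> \<open>Symmetry of the mixed partials and the vanishing Laplacian together are the
      Cauchy-Riemann equations for \<open>F\<close>.\<close>
    have sym: "uxy z = uyx z"
      by (rule mixed_partials_eq[OF S(1) z u ux uy cont])
    have yy: "uyy z = - uxx z" using lap[OF z] by (simp add: add_eq_0_iff)
    have "(F has_derivative (\<lambda>h. ((Re h *\<^sub>R uxx z + Im h *\<^sub>R uxy z) - \<i> * (Re h *\<^sub>R uyx z + Im h *\<^sub>R uyy z)) / 2)) (at z)"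
      unfolding F_def using ux[OF z] uy[OF z]
      by (auto intro!: derivative_eq_intros simp: scaleR_conv_of_real field_simps)
    then show ?thesis
      unfolding has_field_derivative_def
    proof (rule has_derivative_eq_rhs, intro ext)
      fix h
      show "((Re h *\<^sub>R uxx z + Im h *\<^sub>R uxy z) - \<i> * (Re h *\<^sub>R uyx z + Im h *\<^sub>R uyy z)) / 2
        = (uxx z - \<i> * uyx z) / 2 * h"
        unfolding sym yy by (simp add: complex_eq_iff field_simps)
    qed
  qed
  then have "F holomorphic_on S"
    using S(1) by (auto simp: holomorphic_on_open)
  have "\<exists>f. \<forall>z\<in>S. (f has_field_derivative F z) (at z within S)"
  proof (rule holomorphic_convex_primitive'[OF S(2,1) \<open>F holomorphic_on S\<close>])
    fix f assume f: "\<And>z. z \<in> S \<Longrightarrow> (f has_field_derivative F z) (at z within S)"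
    show ?thesis by (intro exI[of _ f] ballI f)
  qed
  then obtain f where "\<forall>z\<in>S. (f has_field_derivative F z) (at z within S)" ..
  then have f: "(f has_field_derivative F z) (at z within S)" if "z \<in> S" for z
    using that by (rule bspec)
  \<comment> \<open>\<open>F\<close> is the Wirtinger derivative of \<open>u\<close> with respect to
    \<open>z\<close>. Subtracting its primitive leaves an antiholomorphic function, whose conjugate
    is holomorphic.\<close>
  define g where "g = (\<lambda>z. cnj (u z - f z))"
  have "(g has_field_derivative cnj ((ux z + \<i> * uy z) / 2)) (at z)" if z: "z \<in> S" for z
  proof -
    have "(f has_derivative (\<lambda>h. F z * h)) (at z)"
      using f[OF z] unfolding has_field_derivative_def at_within_open[OF z S(1)] .
    from has_derivative_diff[OF u[OF z] this]
    have "((\<lambda>z. u z - f z) has_derivative (\<lambda>h. Re h *\<^sub>R ux z + Im h *\<^sub>R uy z - F z * h)) (at z)" .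
    from bounded_linear.has_derivative[OF bounded_linear_cnj this]
    have "(g has_derivative (\<lambda>h. cnj (Re h *\<^sub>R ux z + Im h *\<^sub>R uy z - F z * h))) (at z)"
      unfolding g_def .
    then show ?thesis
      unfolding has_field_derivative_def
    proof (rule has_derivative_eq_rhs, intro ext)
      fix h
      show "cnj (Re h *\<^sub>R ux z + Im h *\<^sub>R uy z - F z * h) = cnj ((ux z + \<i> * uy z) / 2) * h"
        by (simp add: F_def complex_eq_iff field_simps)
    qed
  qed
  then have g: "g holomorphic_on S"
    using S(1) by (auto simp: holomorphic_on_open)
  have "f holomorphic_on S"
    unfolding holomorphic_on_def field_differentiable_def using f by blast
  from this g show thesis
  proof (rule that)
    show "u z = f z + cnj (g z)" for z by (simp add: g_def)
  qed
qed

section \<open>Moments and orthogonality in the harmonic Bergman space\<close>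

text \<open>Cut off outside the disk, as membership in \<open>L2h\<close> prescribes.\<close>

definition zpow :: "nat \<Rightarrow> complex \<Rightarrow> complex" where
  "zpow n z = (if z \<in> disk then z ^ n else 0)"

text \<open>For radial f this is a Mellin transform: twice the integral of
  \<open>f r * r powr (x + 1)\<close> over r in [0,1].\<close>

definition moment :: "(complex \<Rightarrow> complex) \<Rightarrow> real \<Rightarrow> complex" where
  "moment f x = (\<integral>z. f z * of_real (cmod z powr x) \<partial>dA)"

text \<open>The numerator is the inner product of \<open>e^{ip\<theta>} f z^n\<close> with
  \<open>z^(n+p)\<close>, the denominator the squared norm of \<open>z^(n+p)\<close>.\<close>

definition toeplitz_coef :: "(complex \<Rightarrow> complex) \<Rightarrow> nat \<Rightarrow> nat \<Rightarrow> complex" where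
  "toeplitz_coef f p n = moment f (2 * n + p) / moment (\<lambda>_. 1) (2 * n + 2 * p)"

text \<open>No growth condition at the unit circle is imposed on \<open>f\<close>. The support of
  \<open>H\<close> in radius \<open>\<rho> < 1\<close> compensates: there the Taylor series
  converges absolutely and uniformly, so it may be integrated term by term.\<close>

lemma sums_integral_power_series:
  fixes f H :: "complex \<Rightarrow> complex"
  assumes f: "f holomorphic_on disk" and H: "integrable dA H"
    and \<rho>: "0 < \<rho>" "\<rho> < 1" and supp: "\<And>z. z \<in> disk \<Longrightarrow> cmod z > \<rho> \<Longrightarrow> H z = 0"
  shows "(\<lambda>k. (deriv ^^ k) f 0 / fact k * (\<integral>z. H z * z ^ k \<partial>dA)) sums (\<integral>z. H z * f z \<partial>dA)"
proof -
  define a where "a = (\<lambda>k. (deriv ^^ k) f 0 / fact k)"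
  have ser: "(\<lambda>k. a k * z ^ k) sums f z" if "z \<in> disk" for z
    using holomorphic_power_series[OF f that] by (simp add: a_def)
  have absum: "summable (\<lambda>k. norm (a k * z ^ k))" if "z \<in> disk" for z
  proof -
    \<comment> \<open>A radius strictly between \<open>cmod z\<close> and 1: convergence at r gives
      absolute convergence at z.\<close>
    define r where "r = (1 + cmod z) / 2"
    have r: "cmod z < r" "r < 1" using that by (auto simp: r_def)
    have "0 \<le> r" using r(1) norm_ge_zero[of z] by linarith
    then have "complex_of_real r \<in> disk" using r by simp
    then have "summable (\<lambda>k. a k * of_real r ^ k)" using ser sums_summable by blast
    then show ?thesis
      by (rule powser_insidea) (use r \<open>0 \<le> r\<close> in simp)
  qed
  have int: "integrable dA (\<lambda>z. H z * (a k * z ^ k))" for k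
    by (intro integrable_dA_mult_continuous H continuous_intros)
  have "(\<lambda>k. \<integral>z. H z * (a k * z ^ k) \<partial>dA) sums (\<integral>z. (\<Sum>k. H z * (a k * z ^ k)) \<partial>dA)"
  proof (rule sums_integral[OF int])
    show "AE z in dA. summable (\<lambda>k. norm (H z * (a k * z ^ k)))"
      using absum by (intro AE_I2) (simp add: norm_mult summable_mult)
    have "complex_of_real \<rho> \<in> disk" using \<rho> by simp
    from absum[OF this] have s: "summable (\<lambda>k. norm (a k) * \<rho> ^ k * (\<integral>z. norm (H z) \<partial>dA))"
      using \<rho> by (intro summable_mult2) (simp add: norm_mult norm_power)
    show "summable (\<lambda>k. \<integral>z. norm (H z * (a k * z ^ k)) \<partial>dA)"
    proof (rule summable_comparison_test'[OF s, of 0])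
      fix k
      have "(\<integral>z. norm (H z * (a k * z ^ k)) \<partial>dA) \<le> (\<integral>z. norm (a k) * \<rho> ^ k * norm (H z) \<partial>dA)"
      proof (rule integral_mono)
        show "integrable dA (\<lambda>z. norm (H z * (a k * z ^ k)))" using int by (rule integrable_norm)
        show "integrable dA (\<lambda>z. norm (a k) * \<rho> ^ k * norm (H z))" using H by simp
        fix z assume z: "z \<in> space dA"
        show "norm (H z * (a k * z ^ k)) \<le> norm (a k) * \<rho> ^ k * norm (H z)"
        proof (cases "cmod z > \<rho>")
          case True
          then show ?thesis using supp z by simp
        next
          case False
          then have "cmod z ^ k \<le> \<rho> ^ k" by (intro power_mono) auto
          then have "norm (H z) * (norm (a k) * cmod z ^ k) \<le> norm (H z) * (norm (a k) * \<rho> ^ k)"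
            by (intro mult_left_mono) auto
          then show ?thesis by (simp add: norm_mult norm_power mult_ac)
        qed
      qed
      then show "norm (\<integral>z. norm (H z * (a k * z ^ k)) \<partial>dA) \<le> norm (a k) * \<rho> ^ k * (\<integral>z. norm (H z) \<partial>dA)"
        by simp
    qed
  qed
  moreover have "(\<integral>z. H z * (a k * z ^ k) \<partial>dA) = a k * (\<integral>z. H z * z ^ k \<partial>dA)" for k
    by (simp only: mult.left_commute[of _ "a k"] integral_mult_right_zero)
  moreover have "(\<integral>z. (\<Sum>k. H z * (a k * z ^ k)) \<partial>dA) = (\<integral>z. H z * f z \<partial>dA)"
    using ser by (intro Bochner_Integration.integral_cong refl sums_unique[symmetric] sums_mult) simp
  ultimately show ?thesis by (simp add: a_def)
qed

lemma L2h_L1: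
  assumes "v \<in> L2h"
  shows "v \<in> borel_measurable dA" "integrable dA v"
proof -
  have v: "v \<in> borel_measurable dA" "integrable dA (\<lambda>z. (cmod (v z))\<^sup>2)"
    using assms by (auto simp: L2h_def L2_def)
  show "v \<in> borel_measurable dA" by (rule v)
  have "integrable dA (\<lambda>z. cmod (v z))"
    by (rule dA.square_integrable_imp_integrable[OF measurable_compose[OF v(1) borel_measurable_norm] v(2)])
  then show "integrable dA v"
    by (simp only: integrable_norm_iff[OF v(1)])
qed

text \<open>Among the terms \<open>z ^ k\<close> and \<open>cnj z ^ k\<close> of a harmonic
  function, only \<open>z ^ m\<close> has the positive angular degree m, so orthogonality to that
  monomial gives orthogonality to all of \<open>L2h\<close>. The parts \<open>f\<close> and
  \<open>g\<close> of \<open>v\<close> are not known to be integrable separately. Hence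
  \<open>G\<close> is first truncated to smaller disks, where the series may be used, and the limit
  is taken for \<open>v\<close> as a whole.\<close>

lemma integral_angular_degree_L2h_eq_0:
  fixes G v :: "complex \<Rightarrow> complex"
  assumes v: "v \<in> L2h"
    and G: "G \<in> borel_measurable dA" "\<And>z. z \<in> disk \<Longrightarrow> norm (G z) \<le> B"
    and rot: "\<And>w z. cmod w = 1 \<Longrightarrow> z \<in> disk - {0} \<Longrightarrow> G (w * z) = w ^ m * G z"
    and m: "m > 0" and zero: "(\<integral>z. G z * cnj (z ^ m) \<partial>dA) = 0"
  shows "(\<integral>z. G z * cnj (v z) \<partial>dA) = 0"
proof -
  have "harmonic_on disk v" using v by (simp add: L2h_def)
  then obtain f g where f: "f holomorphic_on disk" and g: "g holomorphic_on disk"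
    and vfg: "\<And>z. z \<in> disk \<Longrightarrow> v z = f z + cnj (g z)"
    using harmonic_on_decomposition[of disk v] by auto
  have intG: "integrable dA G"
    using G by (intro dA.integrable_const_bound[where B = B]) auto
  \<comment> \<open>With n + 2 the radii lie strictly between 0 and 1 already for n = 0, and they
    increase to 1.\<close>
  define A where "A = (\<lambda>n::nat. cball (0::complex) (1 - inverse (n + 2)))"
  define H where "H = (\<lambda>n z. indicator (A n) z * G z)"
  have mA [measurable]: "A n \<inter> disk \<in> sets dA" for n
    by (auto simp: sets_dA sets_restrict_space_iff A_def)
  have indA: "(\<lambda>z. indicator (A n) z :: complex) \<in> borel_measurable dA" for n
  proof -
    have "(\<lambda>z. indicator (A n \<inter> disk) z :: complex) \<in> borel_measurable dA" by measurable
    then show ?thesis by (rule measurable_cong[THEN iffD1, rotated]) (auto simp: indicator_def)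
  qed
  have intH: "integrable dA (H n)" for n
  proof -
    have "integrable dA (\<lambda>z. G z * indicator (A n) z)"
      by (rule integrable_mult_bounded[OF intG indA, of _ 1]) (auto simp: indicator_def)
    then show ?thesis by (simp add: H_def mult.commute)
  qed
  have \<rho>: "0 < 1 - inverse (real n + 2)" "1 - inverse (real n + 2) < 1" for n
    by (simp_all add: field_simps)
  have rotH: "H n (w * z) = w ^ m * H n z" if "cmod w = 1" "z \<in> disk - {0}" for n w z
    using rot[OF that] that(1) by (auto simp: H_def A_def indicator_def norm_mult)
  have suppH: "H n z = 0" if "cmod z > 1 - inverse (real n + 2)" for n z
    using that by (simp add: H_def A_def add.commute)
  have "w \<noteq> 0 \<and> cnj w = inverse w" if "cmod w = 1" for w
    using that by (auto simp: complex_norm_square[symmetric] inverse_complex_def complex_eq_iff cmod_def)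
  note cnjw = this
  define a where "a = (\<lambda>k. (deriv ^^ k) f 0 / fact k)"
  have Hv: "(\<integral>z. H n z * cnj (v z) \<partial>dA) = cnj (a m) * (\<integral>z. H n z * cnj (z ^ m) \<partial>dA)" for n
  proof -
    \<comment> \<open>The part \<open>cnj (g z)\<close> of \<open>v\<close> is conjugated back to
      \<open>g z\<close> in the inner product. Each of its terms then has total degree
      \<open>m + k > 0\<close> and integrates to zero.\<close>
    have 1: "(\<integral>z. H n z * z ^ k \<partial>dA) = 0" for k
    proof (rule integral_dA_eq_0_of_angular_degree[where k = "int (m + k)"])
      show "(\<lambda>z. H n z * z ^ k) \<in> borel_measurable dA"
        by (intro borel_measurable_integrable integrable_dA_mult_continuous[OF intH] continuous_intros)
      show "H n (w * z) * (w * z) ^ k = w powi int (m + k) * (H n z * z ^ k)"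
        if "cmod w = 1" "z \<in> disk - {0}" for w z
        using rotH[OF that, of n] by (simp only: power_int_of_nat) (simp add: power_mult_distrib power_add)
    qed (use m in simp)
    have intH': "integrable dA (\<lambda>z. cnj (H n z))" using intH by simp
    \<comment> \<open>The holomorphic part is handled after conjugating the integral; the degree is
      then \<open>k - m\<close>, and only \<open>k = m\<close> survives.\<close>
    have 2: "(\<integral>z. cnj (H n z) * z ^ k \<partial>dA) = 0" if "k \<noteq> m" for k
    proof (rule integral_dA_eq_0_of_angular_degree[where k = "int k - int m"])
      show "(\<lambda>z. cnj (H n z) * z ^ k) \<in> borel_measurable dA"
        by (intro borel_measurable_integrable integrable_dA_mult_continuous[OF intH'] continuous_intros)
      show "cnj (H n (w * z)) * (w * z) ^ k = w powi (int k - int m) * (cnj (H n z) * z ^ k)"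
        if "cmod w = 1" "z \<in> disk - {0}" for w z
        using rotH[OF that, of n] cnjw[OF that(1)]
        by (simp add: power_mult_distrib power_int_diff divide_inverse power_inverse)
    qed (use that in simp)
    have "(\<lambda>k. (deriv ^^ k) g 0 / fact k * (\<integral>z. H n z * z ^ k \<partial>dA)) sums (\<integral>z. H n z * g z \<partial>dA)"
      using suppH by (intro sums_integral_power_series[OF g intH \<rho>]) auto
    then have g0: "(\<integral>z. H n z * g z \<partial>dA) = 0"
      by (simp add: 1 sums_iff)
    have "(\<lambda>k. a k * (\<integral>z. cnj (H n z) * z ^ k \<partial>dA)) sums (\<integral>z. cnj (H n z) * f z \<partial>dA)"
      unfolding a_def using suppH by (intro sums_integral_power_series[OF f intH' \<rho>]) auto
    moreover have "(\<lambda>k. a k * (\<integral>z. cnj (H n z) * z ^ k \<partial>dA)) sums (a m * (\<integral>z. cnj (H n z) * z ^ m \<partial>dA))"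
      using 2 sums_finite[of "{m}" "\<lambda>k. a k * (\<integral>z. cnj (H n z) * z ^ k \<partial>dA)"] by auto
    ultimately have f0: "(\<integral>z. cnj (H n z) * f z \<partial>dA) = a m * (\<integral>z. cnj (H n z) * z ^ m \<partial>dA)"
      by (rule sums_unique2)
    have "(\<integral>z. H n z * cnj (f z) \<partial>dA) = cnj (\<integral>z. cnj (H n z) * f z \<partial>dA)"
      by (simp only: Bochner_Integration.integral_cnj[symmetric] complex_cnj_mult complex_cnj_cnj)
    also have "\<dots> = cnj (a m) * (\<integral>z. H n z * cnj (z ^ m) \<partial>dA)"
      unfolding f0 complex_cnj_mult by (simp only: Bochner_Integration.integral_cnj[symmetric] complex_cnj_mult complex_cnj_cnj)
    finally have f1: "(\<integral>z. H n z * cnj (f z) \<partial>dA) = cnj (a m) * (\<integral>z. H n z * cnj (z ^ m) \<partial>dA)" .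
    have inthol: "integrable dA (\<lambda>z. H n z * q z)" if q: "continuous_on disk q" for q
    proof -
      have "A n \<subseteq> disk"
      proof
        fix z assume "z \<in> A n"
        then have "cmod z \<le> 1 - inverse (real n + 2)" by (simp add: A_def add.commute)
        then have "cmod z < 1" using \<rho>(2) by (rule le_less_trans)
        then show "z \<in> disk" by simp
      qed
      with q have "continuous_on (A n) q" by (rule continuous_on_subset)
      then have "bounded (q ` A n)"
        by (intro compact_imp_bounded compact_continuous_image) (auto simp: A_def)
      then obtain C where C: "\<forall>z\<in>A n. norm (q z) \<le> C" unfolding bounded_iff by blast
      have "integrable dA (\<lambda>z. H n z * (indicator (A n) z * q z))"
      proof (rule integrable_mult_bounded[OF intH])
        show "(\<lambda>z. indicator (A n) z * q z) \<in> borel_measurable dA"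
          using indA borel_measurable_dA_continuous_on[OF q] by measurable
        show "norm (indicator (A n) z * q z) \<le> max C 0" for z
          using C by (auto simp: indicator_def le_max_iff_disj)
      qed
      moreover have "H n z * (indicator (A n) z * q z) = H n z * q z" for z
        by (simp add: H_def indicator_def)
      ultimately show ?thesis by simp
    qed
    have "(\<integral>z. H n z * cnj (v z) \<partial>dA) = (\<integral>z. H n z * cnj (f z) + H n z * g z \<partial>dA)"
      by (intro Bochner_Integration.integral_cong) (auto simp: vfg algebra_simps)
    also have "\<dots> = (\<integral>z. H n z * cnj (f z) \<partial>dA) + (\<integral>z. H n z * g z \<partial>dA)"
      using f g by (intro Bochner_Integration.integral_add inthol continuous_intros holomorphic_on_imp_continuous_on)
    finally show ?thesis using f1 g0 by simp
  qed
  have lim: "(\<lambda>n. \<integral>z. H n z * q z \<partial>dA) \<longlonglongrightarrow> (\<integral>z. G z * q z \<partial>dA)"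
    if q: "integrable dA (\<lambda>z. G z * q z)" "q \<in> borel_measurable dA" for q
  proof (rule integral_dominated_convergence[where w = "\<lambda>z. norm (G z * q z)"])
    show "(\<lambda>z. H n z * q z) \<in> borel_measurable dA" for n
      using intH q(2) by measurable
    show "AE z in dA. norm (H n z * q z) \<le> norm (G z * q z)" for n
      by (auto simp: H_def norm_mult indicator_def)
    show "AE z in dA. (\<lambda>n. H n z * q z) \<longlonglongrightarrow> G z * q z"
    proof (rule AE_I2)
      fix z assume "z \<in> space dA"
      then have "0 < 1 - cmod z" by simp
      have "(\<lambda>n. inverse (real n + 2)) \<longlonglongrightarrow> 0"
        using LIMSEQ_ignore_initial_segment[OF lim_inverse_n, of 2] by (simp add: add.commute)
      then have "\<forall>\<^sub>F n in sequentially. inverse (real n + 2) < 1 - cmod z"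
        using \<open>0 < 1 - cmod z\<close> by (rule order_tendstoD)
      then have "\<forall>\<^sub>F n in sequentially. H n z * q z = G z * q z"
        by eventually_elim (auto simp: H_def A_def indicator_def add.commute)
      then show "(\<lambda>n. H n z * q z) \<longlonglongrightarrow> G z * q z"
        by (rule tendsto_eventually)
    qed
  qed (use q in auto)
  have bG: "integrable dA (\<lambda>z. G z * q z)" if "integrable dA q" for q
    using integrable_mult_bounded[OF that G(1), of B] G(2) by (simp add: mult.commute)
  have cv: "integrable dA (\<lambda>z. cnj (v z))" using L2h_L1(2)[OF v] by simp
  have "(\<lambda>n. \<integral>z. H n z * cnj (v z) \<partial>dA) \<longlonglongrightarrow> (\<integral>z. G z * cnj (v z) \<partial>dA)"
    by (intro lim bG cv borel_measurable_integrable[OF cv])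
  moreover have "(\<lambda>n. \<integral>z. H n z * cnj (v z) \<partial>dA) \<longlonglongrightarrow> cnj (a m) * (\<integral>z. G z * cnj (z ^ m) \<partial>dA)"
  proof -
    have "(\<lambda>z::complex. cnj (z ^ m)) \<in> borel_measurable dA"
      by (intro borel_measurable_dA_continuous_on continuous_intros)
    moreover have "integrable dA (\<lambda>z. G z * cnj (z ^ m))"
      by (intro integrable_dA_mult_continuous intG continuous_intros)
    ultimately show ?thesis
      unfolding Hv by (intro tendsto_mult_left lim)
  qed
  ultimately have "(\<integral>z. G z * cnj (v z) \<partial>dA) = cnj (a m) * (\<integral>z. G z * cnj (z ^ m) \<partial>dA)"
    by (rule LIMSEQ_unique)
  then show ?thesis using zero by simp
qed

section \<open>Toeplitz operators on monomials\<close>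

lemma harmonic_on_holomorphic:
  assumes S: "open S" and f: "f holomorphic_on S" and u: "\<And>z. z \<in> S \<Longrightarrow> u z = f z"
  shows "harmonic_on S u"
proof -
  have D: "(g has_derivative (\<lambda>h. Re h *\<^sub>R deriv g z + Im h *\<^sub>R (\<i> * deriv g z))) (at z)"
    if "g holomorphic_on S" "z \<in> S" for g z
  proof (rule has_derivative_eq_rhs)
    show "(g has_derivative (\<lambda>h. deriv g z * h)) (at z)"
      using holomorphic_derivI[OF that(1) S that(2)] unfolding has_field_derivative_def .
    show "(\<lambda>h. deriv g z * h) = (\<lambda>h. Re h *\<^sub>R deriv g z + Im h *\<^sub>R (\<i> * deriv g z))"
      by (rule ext) (simp add: complex_eq_iff field_simps)
  qed
  have f': "deriv f holomorphic_on S" using holomorphic_deriv[OF f S] .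
  have f'': "continuous_on S (deriv (deriv f))"
    using holomorphic_deriv[OF f' S] holomorphic_on_imp_continuous_on by blast
  have D2: "((\<lambda>z. \<i> * deriv f z) has_derivative (\<lambda>h. Re h *\<^sub>R (\<i> * deriv (deriv f) z) + Im h *\<^sub>R (- deriv (deriv f) z))) (at z)"
    if "z \<in> S" for z
    by (rule has_derivative_eq_rhs[OF has_derivative_mult_right[OF D[OF f' that]]])
       (auto simp: complex_eq_iff)
  show ?thesis
    unfolding harmonic_on_def
  proof (intro exI conjI ballI)
    fix z assume z: "z \<in> S"
    show "(u has_derivative (\<lambda>h. Re h *\<^sub>R deriv f z + Im h *\<^sub>R (\<i> * deriv f z))) (at z)"
      by (rule has_derivative_transform_within_open[OF D[OF f z] S z]) (simp add: u)
    show "(deriv f has_derivative (\<lambda>h. Re h *\<^sub>R deriv (deriv f) z + Im h *\<^sub>R (\<i> * deriv (deriv f) z))) (at z)"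
      by (rule D[OF f' z])
    show "((\<lambda>z. \<i> * deriv f z) has_derivative (\<lambda>h. Re h *\<^sub>R (\<i> * deriv (deriv f) z) + Im h *\<^sub>R (- deriv (deriv f) z))) (at z)"
      by (rule D2[OF z])
    show "deriv (deriv f) z + - deriv (deriv f) z = 0" by simp
  qed (intro continuous_intros f'')+
qed

lemma harmonic_on_diff:
  assumes "harmonic_on S u" "harmonic_on S v"
  shows "harmonic_on S (\<lambda>z. u z - v z)"
proof -
  obtain ux uy uxx uxy uyx uyy where
    u: "\<And>z. z \<in> S \<Longrightarrow> (u has_derivative (\<lambda>h. Re h *\<^sub>R ux z + Im h *\<^sub>R uy z)) (at z)"
      "\<And>z. z \<in> S \<Longrightarrow> (ux has_derivative (\<lambda>h. Re h *\<^sub>R uxx z + Im h *\<^sub>R uxy z)) (at z)"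
      "\<And>z. z \<in> S \<Longrightarrow> (uy has_derivative (\<lambda>h. Re h *\<^sub>R uyx z + Im h *\<^sub>R uyy z)) (at z)"
    and uc: "continuous_on S uxx" "continuous_on S uxy" "continuous_on S uyx" "continuous_on S uyy"
    and ul: "\<And>z. z \<in> S \<Longrightarrow> uxx z + uyy z = 0"
    using assms(1) unfolding harmonic_on_def by blast
  obtain vx vy vxx vxy vyx vyy where
    v: "\<And>z. z \<in> S \<Longrightarrow> (v has_derivative (\<lambda>h. Re h *\<^sub>R vx z + Im h *\<^sub>R vy z)) (at z)"
      "\<And>z. z \<in> S \<Longrightarrow> (vx has_derivative (\<lambda>h. Re h *\<^sub>R vxx z + Im h *\<^sub>R vxy z)) (at z)"
      "\<And>z. z \<in> S \<Longrightarrow> (vy has_derivative (\<lambda>h. Re h *\<^sub>R vyx z + Im h *\<^sub>R vyy z)) (at z)"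
    and vc: "continuous_on S vxx" "continuous_on S vxy" "continuous_on S vyx" "continuous_on S vyy"
    and vl: "\<And>z. z \<in> S \<Longrightarrow> vxx z + vyy z = 0"
    using assms(2) unfolding harmonic_on_def by blast
  have D: "((\<lambda>z. f z - g z) has_derivative (\<lambda>h. Re h *\<^sub>R (a - c) + Im h *\<^sub>R (b - d))) (at z)"
    if "(f has_derivative (\<lambda>h. Re h *\<^sub>R a + Im h *\<^sub>R b)) (at z)"
      "(g has_derivative (\<lambda>h. Re h *\<^sub>R c + Im h *\<^sub>R d)) (at z)" for f g :: "complex \<Rightarrow> complex" and a b c d z
    by (rule has_derivative_eq_rhs[OF has_derivative_diff[OF that]]) (auto simp: algebra_simps)
  show ?thesis
    unfolding harmonic_on_def
  proof (intro exI conjI ballI)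
    fix z assume z: "z \<in> S"
    show "((\<lambda>z. u z - v z) has_derivative (\<lambda>h. Re h *\<^sub>R (ux z - vx z) + Im h *\<^sub>R (uy z - vy z))) (at z)"
      by (rule D[OF u(1)[OF z] v(1)[OF z]])
    show "((\<lambda>z. ux z - vx z) has_derivative (\<lambda>h. Re h *\<^sub>R (uxx z - vxx z) + Im h *\<^sub>R (uxy z - vxy z))) (at z)"
      by (rule D[OF u(2)[OF z] v(2)[OF z]])
    show "((\<lambda>z. uy z - vy z) has_derivative (\<lambda>h. Re h *\<^sub>R (uyx z - vyx z) + Im h *\<^sub>R (uyy z - vyy z))) (at z)"
      by (rule D[OF u(3)[OF z] v(3)[OF z]])
    show "(uxx z - vxx z) + (uyy z - vyy z) = 0"
      using arg_cong2[OF ul[OF z] vl[OF z], of "(-)"] by (simp add: algebra_simps)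
  qed (intro continuous_on_diff uc vc)+
qed

section \<open>Square integrability and evaluation of the projection\<close>

lemma L2_diff:
  assumes "f \<in> L2" "g \<in> L2"
  shows "(\<lambda>z. f z - g z) \<in> L2"
proof -
  have f: "f \<in> borel_measurable dA" "integrable dA (\<lambda>z. (cmod (f z))\<^sup>2)"
    and g: "g \<in> borel_measurable dA" "integrable dA (\<lambda>z. (cmod (g z))\<^sup>2)"
    using assms by (auto simp: L2_def)
  have m: "(\<lambda>z. f z - g z) \<in> borel_measurable dA" using f g by measurable
  have "integrable dA (\<lambda>z. (cmod (f z - g z))\<^sup>2)"
  proof (rule Bochner_Integration.integrable_bound)
    show "integrable dA (\<lambda>z. 2 * (cmod (f z))\<^sup>2 + 2 * (cmod (g z))\<^sup>2)" using f g by simp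
    show "(\<lambda>z. (cmod (f z - g z))\<^sup>2) \<in> borel_measurable dA" using m by measurable
    have "(cmod (f z - g z))\<^sup>2 \<le> 2 * (cmod (f z))\<^sup>2 + 2 * (cmod (g z))\<^sup>2" for z
    proof -
      have "(cmod (f z - g z))\<^sup>2 \<le> (cmod (f z) + cmod (g z))\<^sup>2"
        by (intro power_mono norm_triangle_ineq4) auto
      also have "\<dots> \<le> 2 * (cmod (f z))\<^sup>2 + 2 * (cmod (g z))\<^sup>2"
        using sum_squares_bound[of "cmod (f z)" "cmod (g z)"] by (simp add: power2_sum)
      finally show ?thesis .
    qed
    then show "AE z in dA. norm ((cmod (f z - g z))\<^sup>2) \<le> norm (2 * (cmod (f z))\<^sup>2 + 2 * (cmod (g z))\<^sup>2)"
      by simp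
  qed
  with m show ?thesis by (simp add: L2_def)
qed

lemma L2_inner_integrable:
  assumes "f \<in> L2" "g \<in> L2"
  shows "integrable dA (\<lambda>z. f z * cnj (g z))"
proof -
  have f: "f \<in> borel_measurable dA" "integrable dA (\<lambda>z. (cmod (f z))\<^sup>2)"
    and g: "g \<in> borel_measurable dA" "integrable dA (\<lambda>z. (cmod (g z))\<^sup>2)"
    using assms by (auto simp: L2_def)
  show ?thesis
  proof (rule Bochner_Integration.integrable_bound)
    show "integrable dA (\<lambda>z. (cmod (f z))\<^sup>2 + (cmod (g z))\<^sup>2)" using f g by simp
    have "(\<lambda>z. cnj (g z)) \<in> borel_measurable dA"
      by (rule measurable_compose[OF g(1)]) (intro borel_measurable_continuous_onI continuous_intros)
    then show "(\<lambda>z. f z * cnj (g z)) \<in> borel_measurable dA" using f by measurable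
    have "cmod (f z) * cmod (g z) \<le> (cmod (f z))\<^sup>2 + (cmod (g z))\<^sup>2" for z
    proof -
      have "0 \<le> cmod (f z) * cmod (g z)" by simp
      with sum_squares_bound[of "cmod (f z)" "cmod (g z)"] show ?thesis by linarith
    qed
    then show "AE z in dA. norm (f z * cnj (g z)) \<le> norm ((cmod (f z))\<^sup>2 + (cmod (g z))\<^sup>2)"
      by (simp add: norm_mult)
  qed
qed

lemma L2h_diff:
  assumes "u \<in> L2h" "v \<in> L2h"
  shows "(\<lambda>z. u z - v z) \<in> L2h"
  using assms L2_diff harmonic_on_diff by (auto simp: L2h_def)

lemma AE_dA_False: "\<not> (AE z in dA. False)"
proof
  assume "AE z in dA. False"
  then have "AE z in lebesgue. z \<notin> disk" by (simp add: AE_dA_iff)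
  then have "negligible disk"
    by (simp add: negligible_iff_null_sets AE_iff_null_sets)
  then show False using open_not_negligible[of disk] by simp
qed

text \<open>A continuous function is nonzero on an open set, and nonempty open sets have positive
  measure. Extension by 0 upgrades this to equality of functions, which the description operator in
  \<open>Q\<close> demands.\<close>

lemma L2h_eq_0_of_AE:
  assumes u: "u \<in> L2h" and AE: "AE z in dA. u z = 0"
  shows "u = (\<lambda>_. 0)"
proof -
  have "continuous_on disk u"
  proof (rule differentiable_imp_continuous_on)
    have "harmonic_on disk u" using u by (simp add: L2h_def)
    then show "u differentiable_on disk"
      unfolding harmonic_on_def differentiable_on_def differentiable_def
      by (meson has_derivative_at_withinI)
  qed
  then have "open (disk \<inter> u -` (- {0}))"
    by (intro continuous_open_preimage) auto
  moreover have "negligible (disk \<inter> u -` (- {0}))"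
  proof -
    have "AE z in lebesgue. z \<notin> disk \<inter> u -` (- {0})"
      using AE unfolding AE_dA_iff by eventually_elim auto
    moreover have "disk \<inter> u -` (- {0}) \<in> sets lebesgue"
      using \<open>open _\<close> by auto
    ultimately show ?thesis
      by (simp add: negligible_iff_null_sets AE_iff_null_sets)
  qed
  ultimately have "disk \<inter> u -` (- {0}) = {}"
    using open_not_negligible by blast
  then have "u z = 0" if "z \<in> disk" for z using that by blast
  moreover have "u z = 0" if "z \<notin> disk" for z using that u by (simp add: L2h_def)
  ultimately show ?thesis by blast
qed

text \<open>\<open>Q\<close> is a definite description, so it is evaluated by exhibiting a
  candidate. The difference of two candidates lies in \<open>L2h\<close> and is orthogonal to
  itself.\<close>

lemma Q_eqI:
  assumes f: "f \<in> L2" and u: "u \<in> L2h"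
    and orth: "\<And>v. v \<in> L2h \<Longrightarrow> L2_inner (\<lambda>z. f z - u z) v = 0"
  shows "Q f = u"
  unfolding Q_def
proof (rule the_equality)
  show "u \<in> L2h \<and> (\<forall>v\<in>L2h. L2_inner (\<lambda>z. f z - u z) v = 0)" using u orth by blast
  fix u' assume u': "u' \<in> L2h \<and> (\<forall>v\<in>L2h. L2_inner (\<lambda>z. f z - u' z) v = 0)"
  define d where "d = (\<lambda>z. u z - u' z)"
  have d: "d \<in> L2h" unfolding d_def using u u' by (intro L2h_diff) auto
  have L: "d \<in> L2" "(\<lambda>z. f z - u z) \<in> L2" "(\<lambda>z. f z - u' z) \<in> L2"
    using d f u u' by (auto simp: L2h_def intro!: L2_diff)
  have "of_real (\<integral>z. (cmod (d z))\<^sup>2 \<partial>dA) = (\<integral>z. d z * cnj (d z) \<partial>dA)"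
    by (simp only: complex_norm_square[symmetric] integral_complex_of_real of_real_power[symmetric])
  also have "\<dots> = (\<integral>z. (f z - u' z) * cnj (d z) - (f z - u z) * cnj (d z) \<partial>dA)"
    by (intro Bochner_Integration.integral_cong) (simp_all add: d_def algebra_simps)
  also have "\<dots> = L2_inner (\<lambda>z. f z - u' z) d - L2_inner (\<lambda>z. f z - u z) d"
    unfolding L2_inner_def using L by (intro Bochner_Integration.integral_diff L2_inner_integrable)
  also have "\<dots> = 0" using orth[OF d] u' d by simp
  finally have "(\<integral>z. (cmod (d z))\<^sup>2 \<partial>dA) = 0" by simp
  then have "AE z in dA. (cmod (d z))\<^sup>2 = 0"
    using L(1) by (subst (asm) integral_nonneg_eq_0_iff_AE) (auto simp: L2_def)
  then have "d = (\<lambda>_. 0)" using L2h_eq_0_of_AE[OF d] by simp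
  then show "u' = u" unfolding d_def by (auto simp: fun_eq_iff)
qed

lemma bounded_in_L2:
  assumes f: "f \<in> borel_measurable dA" and B: "\<And>z. z \<in> disk \<Longrightarrow> norm (f z) \<le> B"
  shows "f \<in> L2"
proof -
  have "integrable dA (\<lambda>z. (cmod (f z))\<^sup>2)"
  proof (rule dA.integrable_const_bound[where B = "B\<^sup>2"])
    show "AE z in dA. norm ((cmod (f z))\<^sup>2) \<le> B\<^sup>2"
      using B by (intro AE_I2) (simp add: power_mono)
    show "(\<lambda>z. (cmod (f z))\<^sup>2) \<in> borel_measurable dA" using f by measurable
  qed
  with f show ?thesis by (simp add: L2_def)
qed

lemma zpow_in_L2h: "(\<lambda>z. a * zpow n z) \<in> L2h"
proof -
  have "(\<lambda>z. a * zpow n z) \<in> L2"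
  proof (rule bounded_in_L2[where B = "norm a"])
    have "continuous_on disk (\<lambda>z. a * z ^ n)" by (intro continuous_intros)
    then have "continuous_on disk (\<lambda>z. a * zpow n z)"
      by (rule continuous_on_eq) (simp add: zpow_def)
    then show "(\<lambda>z. a * zpow n z) \<in> borel_measurable dA"
      by (rule borel_measurable_dA_continuous_on)
    show "norm (a * zpow n z) \<le> norm a" if "z \<in> disk" for z
      using that by (simp add: zpow_def norm_mult norm_power mult_left_le power_le_one)
  qed
  moreover have "harmonic_on disk (\<lambda>z. a * zpow n z)"
    by (rule harmonic_on_holomorphic[where f = "\<lambda>z. a * z ^ n"])
       (auto simp: zpow_def intro!: holomorphic_intros)
  ultimately show ?thesis by (auto simp: L2h_def zpow_def)
qed

section \<open>Quasihomogeneous symbols and their Toeplitz coefficients\<close>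

text \<open>Replaces \<open>Arg\<close>, which jumps across the negative axis, by an algebraic
  expression whose measurability and behaviour under rotation are evident.\<close>

lemma quasihom_nonzero:
  assumes "z \<noteq> 0"
  shows "quasihom p \<phi> z = (z / of_real (cmod z)) ^ p * \<phi> z"
proof -
  have "exp (\<i> * of_real (Arg z)) = z / of_real (cmod z)"
    using Arg_eq[OF assms] assms by (simp add: field_simps)
  moreover have "exp (\<i> * of_nat p * of_real (Arg z)) = exp (\<i> * of_real (Arg z)) ^ p"
    by (simp add: exp_of_nat_mult[symmetric] mult_ac)
  ultimately show ?thesis by (simp add: quasihom_def)
qed

lemma radial_rotate:
  assumes "radial \<phi>" "cmod w = 1" "z \<in> disk"
  shows "\<phi> (w * z) = \<phi> z"
proof -
  have "cmod (w * z) = cmod z" "w * z \<in> disk"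
    using assms by (simp_all add: norm_mult)
  then show ?thesis using assms unfolding radial_def by blast
qed

lemma norm_quasihom: "cmod (quasihom p \<phi> z) = cmod (\<phi> z)"
proof -
  have "\<i> * of_nat p * of_real (Arg z) = \<i> * complex_of_real (of_nat p * Arg z)" by simp
  then have "cmod (exp (\<i> * of_nat p * of_real (Arg z))) = 1"
    by (simp only: norm_exp_i_times)
  then show ?thesis by (simp add: quasihom_def norm_mult)
qed

lemma quasihom_measurable:
  assumes "\<phi> \<in> borel_measurable dA"
  shows "quasihom p \<phi> \<in> borel_measurable dA"
proof -
  have "(\<lambda>z. if z = 0 then 1 else (z / complex_of_real (cmod z)) ^ p) \<in> borel_measurable borel"
    by measurable
  then have "(\<lambda>z. if z = 0 then 1 else (z / complex_of_real (cmod z)) ^ p) \<in> borel_measurable dA"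
    unfolding measurable_cong_sets[OF sets_dA refl]
    by (intro measurable_restrict_space1 measurable_completion) simp
  with assms have "(\<lambda>z. (if z = 0 then 1 else (z / complex_of_real (cmod z)) ^ p) * \<phi> z) \<in> borel_measurable dA"
    by measurable
  moreover have "quasihom p \<phi> = (\<lambda>z. (if z = 0 then 1 else (z / complex_of_real (cmod z)) ^ p) * \<phi> z)"
  proof
    fix z show "quasihom p \<phi> z = (if z = 0 then 1 else (z / complex_of_real (cmod z)) ^ p) * \<phi> z"
      by (cases "z = 0") (simp_all add: quasihom_nonzero, simp add: quasihom_def Arg_zero)
  qed
  ultimately show ?thesis by simp
qed

text \<open>The origin has to be left out: at \<open>k = 0\<close> the two sides there are governed
  by \<open>0 ^ 0 = 1\<close> and \<open>0 powr 0 = 0\<close>.\<close>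

lemma AE_dA_eq_mult_powr:
  fixes f :: "complex \<Rightarrow> complex"
  shows "AE z in dA. f z * of_real (cmod z ^ k) = f z * of_real (cmod z powr real k)"
  using AE_dA_nonzero by eventually_elim (simp add: powr_realpow)

lemma integrable_bounded_symbol:
  assumes "bounded_symbol f"
  shows "integrable dA f"
proof -
  obtain B where "\<forall>z\<in>disk. norm (f z) \<le> B"
    using assms unfolding bounded_symbol_def bounded_iff by blast
  then show ?thesis
    using assms by (intro dA.integrable_const_bound[where B = B]) (auto simp: bounded_symbol_def)
qed

lemma cmod_measurable_dA [measurable]: "cmod \<in> borel_measurable dA"
  by (intro borel_measurable_dA_continuous_on continuous_intros)

lemma integrable_mult_cmod_powr:
  fixes f :: "complex \<Rightarrow> complex"
  assumes "integrable dA f" "x \<ge> 0"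
  shows "integrable dA (\<lambda>z. f z * of_real (cmod z powr x))"
  using assms(2) by (intro integrable_mult_bounded[OF assms(1), where B = 1]) (auto simp: powr_le1)

lemma integral_cmod_power_eq_moment:
  assumes "integrable dA f"
  shows "(\<integral>z. f z * of_real (cmod z ^ k) \<partial>dA) = moment f (real k)"
  unfolding moment_def
proof (rule integral_cong_AE)
  show "(\<lambda>z. f z * of_real (cmod z ^ k)) \<in> borel_measurable dA"
    by (intro borel_measurable_integrable integrable_dA_mult_continuous[OF assms] continuous_intros)
  show "(\<lambda>z. f z * of_real (cmod z powr real k)) \<in> borel_measurable dA"
    by (intro borel_measurable_integrable integrable_mult_cmod_powr assms) simp
qed (rule AE_dA_eq_mult_powr)

lemma moment_1_nonzero:
  assumes "x \<ge> 0"
  shows "moment (\<lambda>_. 1) x \<noteq> 0"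
proof
  assume "moment (\<lambda>_. 1) x = 0"
  then have "(\<integral>z. cmod z powr x \<partial>dA) = 0"
    by (simp add: moment_def)
  moreover have "integrable dA (\<lambda>z. cmod z powr x)"
    using assms by (intro dA.integrable_const_bound[where B = 1]) (auto simp: powr_le1)
  ultimately have "AE z in dA. cmod z powr x = 0"
    by (subst (asm) integral_nonneg_eq_0_iff_AE) auto
  with AE_dA_nonzero have "AE z in dA. False"
    by eventually_elim simp
  with AE_dA_False show False by blast
qed

text \<open>The symbol times \<open>z ^ n\<close> has angular degree \<open>n + p > 0\<close>, so
  only its component along \<open>z ^ (n + p)\<close> survives the projection. The scalar
  \<open>a\<close> allows the formula to be applied to its own output.\<close>

lemma toeplitz_quasihom_zpow:
  assumes p: "p > 0" and \<phi>: "bounded_symbol \<phi>" "radial \<phi>"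
  shows "toeplitz (quasihom p \<phi>) (\<lambda>z. a * zpow n z) = (\<lambda>z. a * toeplitz_coef \<phi> p n * zpow (n + p) z)"
  unfolding toeplitz_def
proof (rule Q_eqI)
  let ?F = "\<lambda>z. quasihom p \<phi> z * (a * zpow n z)"
  obtain B where B: "\<forall>z\<in>disk. norm (\<phi> z) \<le> B"
    using \<phi>(1) unfolding bounded_symbol_def bounded_iff by blast
  have mphi: "\<phi> \<in> borel_measurable dA" using \<phi>(1) by (simp add: bounded_symbol_def)
  have mz: "(\<lambda>z. b * zpow k z) \<in> borel_measurable dA" for b k
    using zpow_in_L2h[of b k] L2h_L1(1) by blast
  have nz: "norm (b * zpow k z) \<le> norm b" for b k z
    by (simp add: zpow_def norm_mult norm_power mult_left_le power_le_one)
  have mF: "?F \<in> borel_measurable dA"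
    using quasihom_measurable[OF mphi, of p] mz[of a n] by measurable
  have bF: "norm (?F z) \<le> B * norm a" if "z \<in> disk" for z
  proof -
    have "norm (\<phi> z) \<le> B" using B that by blast
    moreover have "0 \<le> B" using calculation norm_ge_zero[of "\<phi> z"] by linarith
    ultimately show ?thesis
      unfolding norm_mult[of "quasihom p \<phi> z"] norm_quasihom by (intro mult_mono nz) auto
  qed
  show "?F \<in> L2" by (rule bounded_in_L2[OF mF bF])
  show "(\<lambda>z. a * toeplitz_coef \<phi> p n * zpow (n + p) z) \<in> L2h" by (rule zpow_in_L2h)
  define c where "c = toeplitz_coef \<phi> p n"
  define G where "G = (\<lambda>z. ?F z - a * c * zpow (n + p) z)"
  fix v assume v: "v \<in> L2h"
  have "(\<integral>z. G z * cnj (v z) \<partial>dA) = 0"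
  proof (rule integral_angular_degree_L2h_eq_0[OF v, where m = "n + p"])
    show mG: "G \<in> borel_measurable dA"
      unfolding G_def using mF mz[of "a * c" "n + p"] by measurable
    show "norm (G z) \<le> B * norm a + norm (a * c)" if "z \<in> disk" for z
      unfolding G_def using bF[OF that] nz[of "a * c" "n + p" z]
      by (intro order_trans[OF norm_triangle_ineq4] add_mono)
    show "G (w * z) = w ^ (n + p) * G z" if w: "cmod w = 1" and z: "z \<in> disk - {0}" for w z
    proof -
      have "w * z \<in> disk" "w * z \<noteq> 0" "z \<noteq> 0" "z \<in> disk" using w z by (auto simp: norm_mult)
      moreover have "\<phi> (w * z) = \<phi> z" using radial_rotate[OF \<phi>(2) w] z by simp
      ultimately show ?thesis
        using w by (simp add: G_def quasihom_nonzero zpow_def norm_mult power_mult_distrib power_divide power_add algebra_simps)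
    qed
    show "n + p > 0" using p by simp
    have i: "integrable dA \<phi>" "integrable dA (\<lambda>_. 1 :: complex)"
      using integrable_bounded_symbol[OF \<phi>(1)] by auto
    have ib: "integrable dA (\<lambda>z. f z * of_real (cmod z ^ k))" if "integrable dA f" for f :: "complex \<Rightarrow> complex" and k
      by (intro integrable_dA_mult_continuous[OF that] continuous_intros)
    have "(\<integral>z. G z * cnj (z ^ (n + p)) \<partial>dA)
        = (\<integral>z. a * (\<phi> z * of_real (cmod z ^ (2 * n + p))) - a * c * (1 * of_real (cmod z ^ (2 * n + 2 * p))) \<partial>dA)"
    proof (rule integral_cong_AE)
      have "integrable dA G"
        using mG bF nz[of "a * c" "n + p"]
        by (intro dA.integrable_const_bound[where B = "B * norm a + norm (a * c)"] AE_I2)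
           (auto simp: G_def intro!: order_trans[OF norm_triangle_ineq4] add_mono)
      then show "(\<lambda>z. G z * cnj (z ^ (n + p))) \<in> borel_measurable dA"
        by (intro borel_measurable_integrable integrable_dA_mult_continuous continuous_intros)
      show "(\<lambda>z. a * (\<phi> z * of_real (cmod z ^ (2 * n + p))) - a * c * (1 * of_real (cmod z ^ (2 * n + 2 * p)))) \<in> borel_measurable dA"
        by (intro borel_measurable_integrable Bochner_Integration.integrable_diff integrable_mult_right ib i)
      show "AE z in dA. G z * cnj (z ^ (n + p))
          = a * (\<phi> z * of_real (cmod z ^ (2 * n + p))) - a * c * (1 * of_real (cmod z ^ (2 * n + 2 * p)))"
        using AE_dA_nonzero AE_space
      proof eventually_elim
        fix z assume "z \<noteq> 0" "z \<in> space dA"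
        define r where "r = complex_of_real (cmod z)"
        have r: "r \<noteq> 0" and z: "z \<in> disk" using \<open>z \<noteq> 0\<close> \<open>z \<in> space dA\<close> by (auto simp: r_def)
        have "z * cnj z = r\<^sup>2" using complex_norm_square[of z] by (simp add: r_def)
        then have zz: "z ^ (n + p) * cnj z ^ (n + p) = r ^ (2 * n + 2 * p)"
          by (metis power_mult power_mult_distrib distrib_left)
        have "G z * cnj (z ^ (n + p)) = a * (\<phi> z * ((z ^ (n + p) * cnj z ^ (n + p)) / r ^ p)) - a * c * (z ^ (n + p) * cnj z ^ (n + p))"
          using z \<open>z \<noteq> 0\<close> by (simp add: G_def quasihom_nonzero zpow_def r_def power_divide power_add algebra_simps)
        \<comment> \<open>The phase \<open>(z / r) ^ p\<close> of the symbol divides by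
          \<open>r ^ p\<close>, which lowers the exponent from \<open>2 * n + 2 * p\<close> to
          \<open>2 * n + p\<close>.\<close>
        also have "(z ^ (n + p) * cnj z ^ (n + p)) / r ^ p = r ^ (2 * n + p)"
        proof -
          have "r ^ (2 * n + 2 * p) = r ^ (2 * n + p) * r ^ p" by (simp add: power_add[symmetric] mult_2 add.assoc)
          then show ?thesis unfolding zz using r by simp
        qed
        finally show "G z * cnj (z ^ (n + p))
          = a * (\<phi> z * of_real (cmod z ^ (2 * n + p))) - a * c * (1 * of_real (cmod z ^ (2 * n + 2 * p)))"
          unfolding zz by (simp add: r_def)
      qed
    qed
    also have "\<dots> = a * (\<integral>z. \<phi> z * of_real (cmod z ^ (2 * n + p)) \<partial>dA) - a * c * (\<integral>z. 1 * of_real (cmod z ^ (2 * n + 2 * p)) \<partial>dA)"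
      by (subst Bochner_Integration.integral_diff)
         ((intro integrable_mult_right ib i)+, simp only: integral_mult_right_zero)
    also have "\<dots> = a * moment \<phi> (2 * n + p) - a * c * moment (\<lambda>_. 1) (2 * n + 2 * p)"
      by (simp only: integral_cmod_power_eq_moment[OF i(1)] integral_cmod_power_eq_moment[OF i(2)])
    also have "\<dots> = 0"
      using moment_1_nonzero[of "2 * n + 2 * p"] by (simp add: c_def toeplitz_coef_def)
    finally show "(\<integral>z. G z * cnj (z ^ (n + p)) \<partial>dA) = 0" .
  qed
  then show "L2_inner (\<lambda>z. ?F z - a * toeplitz_coef \<phi> p n * zpow (n + p) z) v = 0"
    by (simp only: L2_inner_def G_def c_def)
qed

lemma toeplitz_commute_coef:
  assumes "p > 0" "bounded_symbol \<phi>" "radial \<phi>" "s > 0" "bounded_symbol \<psi>" "radial \<psi>"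
    and comm: "toeplitz_commute (quasihom s \<psi>) (quasihom p \<phi>)"
  shows "toeplitz_coef \<phi> p n * toeplitz_coef \<psi> s (n + p) = toeplitz_coef \<psi> s n * toeplitz_coef \<phi> p (n + s)"
proof -
  note T = toeplitz_quasihom_zpow[OF assms(1-3)] toeplitz_quasihom_zpow[OF assms(4-6)]
  have "toeplitz (quasihom s \<psi>) (toeplitz (quasihom p \<phi>) (\<lambda>z. 1 * zpow n z))
      = toeplitz (quasihom p \<phi>) (toeplitz (quasihom s \<psi>) (\<lambda>z. 1 * zpow n z))"
    using comm zpow_in_L2h unfolding toeplitz_commute_def by blast
  then have "(\<lambda>z. 1 * toeplitz_coef \<phi> p n * toeplitz_coef \<psi> s (n + p) * zpow (n + p + s) z)
      = (\<lambda>z. 1 * toeplitz_coef \<psi> s n * toeplitz_coef \<phi> p (n + s) * zpow (n + s + p) z)"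
    unfolding T .
  \<comment> \<open>Any point of the disk other than the origin would separate the
    coefficients.\<close>
  from fun_cong[OF this, of "1 / 2"] show ?thesis
    by (simp add: zpow_def add_ac)
qed

text \<open>Both compositions end on \<open>z ^ (n + p + s)\<close>, so its squared norm cancels;
  clearing the two remaining denominators leaves three moments on each side.\<close>

lemma toeplitz_commute_moment:
  assumes "p > 0" "bounded_symbol \<phi>" "radial \<phi>" "s > 0" "bounded_symbol \<psi>" "radial \<psi>"
    and comm: "toeplitz_commute (quasihom s \<psi>) (quasihom p \<phi>)"
  shows "moment \<phi> (2 * n + p) * moment \<psi> (2 * n + 2 * p + s) * moment (\<lambda>_. 1) (2 * n + 2 * s)
    = moment \<psi> (2 * n + s) * moment \<phi> (2 * n + 2 * s + p) * moment (\<lambda>_. 1) (2 * n + 2 * p)"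
proof -
  have nz: "moment (\<lambda>_. 1) (2 * real n + 2 * real p) \<noteq> 0" "moment (\<lambda>_. 1) (2 * real n + 2 * real s) \<noteq> 0"
    "moment (\<lambda>_. 1) (2 * real n + 2 * real p + 2 * real s) \<noteq> 0"
    by (intro moment_1_nonzero; simp)+
  show ?thesis
    using toeplitz_commute_coef[OF assms, of n] nz by (simp add: toeplitz_coef_def field_simps add_ac)
qed

section \<open>Commutation and moments\<close>

lemma moment_triple_product:
  assumes f: "integrable dA f1" "integrable dA f2" "integrable dA f3" and x: "x \<ge> 0"
  defines "M \<equiv> dA \<Otimes>\<^sub>M (dA \<Otimes>\<^sub>M dA)"
  shows "integrable M (\<lambda>p. f1 (fst p) * (f2 (fst (snd p)) * f3 (snd (snd p))))"
    and "moment f1 x * (moment f2 x * moment f3 x) =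
      (\<integral>p. f1 (fst p) * (f2 (fst (snd p)) * f3 (snd (snd p)))
          * of_real ((cmod (fst p) * (cmod (fst (snd p)) * cmod (snd (snd p)))) powr x) \<partial>M)"
proof -
  have sf: "sigma_finite_measure dA" "sigma_finite_measure (dA \<Otimes>\<^sub>M dA)"
    by (rule dA.sigma_finite_measure_axioms)
      (intro sigma_finite_pair_measure dA.sigma_finite_measure_axioms)
  show "integrable M (\<lambda>p. f1 (fst p) * (f2 (fst (snd p)) * f3 (snd (snd p))))"
    unfolding M_def by (intro integral_pair_mult(1)[OF sf f(1)] integral_pair_mult(1)[OF sf(1) sf(1) f(2,3)])
  define g where "g = (\<lambda>f z. f z * complex_of_real (cmod z powr x))"
  have g: "integrable dA (g f)" if "integrable dA f" for f
    unfolding g_def by (rule integrable_mult_cmod_powr[OF that x])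
  have "moment f1 x * (moment f2 x * moment f3 x)
     = (\<integral>p. g f1 (fst p) * (g f2 (fst (snd p)) * g f3 (snd (snd p))) \<partial>M)"
    unfolding M_def integral_pair_mult(2)[OF sf g[OF f(1)] integral_pair_mult(1)[OF sf(1) sf(1) g[OF f(2)] g[OF f(3)]]]
      integral_pair_mult(2)[OF sf(1) sf(1) g[OF f(2)] g[OF f(3)]]
    by (simp add: moment_def g_def)
  also have "\<dots> = (\<integral>p. f1 (fst p) * (f2 (fst (snd p)) * f3 (snd (snd p)))
          * of_real ((cmod (fst p) * (cmod (fst (snd p)) * cmod (snd (snd p)))) powr x) \<partial>M)"
    by (intro Bochner_Integration.integral_cong) (simp_all add: g_def powr_mult mult_ac)
  finally show "moment f1 x * (moment f2 x * moment f3 x) =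
      (\<integral>p. f1 (fst p) * (f2 (fst (snd p)) * f3 (snd (snd p)))
          * of_real ((cmod (fst p) * (cmod (fst (snd p)) * cmod (snd (snd p)))) powr x) \<partial>M)" .
qed

text \<open>A product of moments is a moment on the product space, so the progression principle applies.\<close>

lemma moment_triple_eq_of_progression:
  assumes f: "integrable dA f1" "integrable dA f2" "integrable dA f3"
    and g: "integrable dA g1" "integrable dA g2" "integrable dA g3"
    and c: "c > 0" and d: "d > 0"
    and eq: "\<And>n::nat. moment f1 (c + d * n) * (moment f2 (c + d * n) * moment f3 (c + d * n))
               = moment g1 (c + d * n) * (moment g2 (c + d * n) * moment g3 (c + d * n))"
    and x: "x > c"
  shows "moment f1 x * (moment f2 x * moment f3 x) = moment g1 x * (moment g2 x * moment g3 x)"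
proof -
  define M where "M = dA \<Otimes>\<^sub>M (dA \<Otimes>\<^sub>M dA)"
  define F where "F = (\<lambda>p. f1 (fst p) * (f2 (fst (snd p)) * f3 (snd (snd p))))"
  define G where "G = (\<lambda>p. g1 (fst p) * (g2 (fst (snd p)) * g3 (snd (snd p))))"
  define u where "u = (\<lambda>p::complex \<times> complex \<times> complex. cmod (fst p) * (cmod (fst (snd p)) * cmod (snd (snd p))))"
  have F: "integrable M F" and G: "integrable M G"
    unfolding M_def F_def G_def using moment_triple_product(1)[OF f order_refl] moment_triple_product(1)[OF g order_refl] .
  have u: "u \<in> borel_measurable M"
    unfolding u_def M_def by measurable
  have u01: "u p \<in> {0..1}" if "p \<in> space M" for p
  proof -
    have "cmod (fst p) \<le> 1" "cmod (fst (snd p)) \<le> 1" "cmod (snd (snd p)) \<le> 1"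
      using that by (auto simp: M_def space_pair_measure)
    then show ?thesis by (simp add: u_def mult_le_one)
  qed
  have int: "integrable M (\<lambda>p. h p * of_real (u p powr y))" if "integrable M h" "y \<ge> 0"
    for h :: "complex \<times> complex \<times> complex \<Rightarrow> complex" and y
    using u u01 that(2) by (intro integrable_mult_bounded[OF that(1), where B = 1]) (auto simp: powr_le1)
  have diff: "(\<integral>p. (F p - G p) * of_real (u p powr y) \<partial>M)
      = moment f1 y * (moment f2 y * moment f3 y) - moment g1 y * (moment g2 y * moment g3 y)" if "y \<ge> 0" for y
    using int[OF F that] int[OF G that] moment_triple_product(2)[OF f that] moment_triple_product(2)[OF g that]
    by (simp add: left_diff_distrib F_def G_def u_def M_def)
  have "(\<integral>p. (F p - G p) * of_real (u p powr x) \<partial>M) = 0"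
  proof (rule integral_powr_eq_0_of_progression[OF _ u u01 d c _ x])
    show "integrable M (\<lambda>p. F p - G p)" using F G by simp
    show "(\<integral>p. (F p - G p) * of_real (u p powr (c + d * real k)) \<partial>M) = 0" for k :: nat
      using c d eq[of k] by (subst diff) auto
  qed
  then show ?thesis using diff[of x] x c by simp
qed

text \<open>Absorbing shifts into the symbol lets moments at different arguments be read at one
  common exponent, the form that the progression principle requires.\<close>

lemma moment_shift: "moment (\<lambda>z. f z * of_real (cmod z powr a)) x = moment f (x + a)"
  by (simp add: moment_def powr_add mult_ac)

text \<open>The weight \<open>cmod z ^ N\<close> with \<open>N > c\<close> pushes every even power,
  including the zeroth, beyond c. It vanishes only at the origin and can be divided out
  afterwards.\<close>

lemma AE_eq_0_of_moment:
  assumes f: "integrable dA f" "radial f" and moment: "\<And>y. y > c \<Longrightarrow> moment f y = 0"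
  shows "AE z in dA. f z = 0"
proof -
  obtain N :: nat where N: "c < N" using reals_Archimedean2 by blast
  have iF: "integrable dA (\<lambda>z. f z * of_real (cmod z ^ N))"
    by (intro integrable_dA_mult_continuous[OF f(1)] continuous_intros)
  have "AE z in dA. f z * of_real (cmod z ^ N) = 0"
  proof (rule AE_dA_eq_0_of_radial_moments[OF iF])
    show "f (w * z) * of_real (cmod (w * z) ^ N) = f z * of_real (cmod z ^ N)"
      if "cmod w = 1" "z \<in> disk - {0}" for w z
      using radial_rotate[OF f(2) that(1)] that by (simp add: norm_mult)
    show "(\<integral>z. f z * of_real (cmod z ^ N) * of_real (cmod z ^ (2 * k)) \<partial>dA) = 0" for k
    proof -
      have "(\<integral>z. f z * of_real (cmod z ^ N) * of_real (cmod z ^ (2 * k)) \<partial>dA)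
          = (\<integral>z. f z * of_real (cmod z ^ (N + 2 * k)) \<partial>dA)"
        by (simp add: power_add mult.assoc)
      then show ?thesis using N moment[of "real (N + 2 * k)"] integral_cmod_power_eq_moment[OF f(1)] by simp
    qed
  qed
  with AE_dA_nonzero show ?thesis by eventually_elim auto
qed

lemma countable_moment_zeros:
  assumes f: "integrable dA f" "radial f" and nz: "\<not> (AE z in dA. f z = 0)"
  shows "countable {y. y > 0 \<and> moment f y = 0}"
proof -
  have "countable {y. y > 0 \<and> moment f y = 0} \<or> (\<forall>y>0. moment f y = 0)"
    unfolding moment_def by (rule integral_powr_zeros[OF f(1)]) auto
  then show ?thesis using AE_eq_0_of_moment[OF f, of 0] nz by blast
qed

section \<open>Uniqueness of the commuting symbol up to a constant\<close>

theorem theorem4: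
  fixes p s :: nat and \<phi> \<psi>1 \<psi>2 :: "complex \<Rightarrow> complex"
  assumes "p > 0" and "s > 0"
    and "bounded_symbol \<phi>" and "radial \<phi>"
    and "\<not> (\<exists>c. AE z in dA. \<phi> z = c)"
    and "bounded_symbol \<psi>1" and "radial \<psi>1"
    and "bounded_symbol \<psi>2" and "radial \<psi>2"
    and "toeplitz_commute (quasihom s \<psi>1) (quasihom p \<phi>)"
    and "toeplitz_commute (quasihom s \<psi>2) (quasihom p \<phi>)"
  shows "(\<exists>c. AE z in dA. \<psi>1 z = c * \<psi>2 z) \<or> (\<exists>c. AE z in dA. \<psi>2 z = c * \<psi>1 z)"
proof (cases "AE z in dA. \<psi>2 z = 0")
  case True
  then have "AE z in dA. \<psi>2 z = 0 * \<psi>1 z" by simp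
  then show ?thesis by blast
next
  case False
  note p = assms(1) and s = assms(2)
  note i\<phi> = integrable_bounded_symbol[OF assms(3)]
  note i1 = integrable_bounded_symbol[OF assms(6)] and i2 = integrable_bounded_symbol[OF assms(8)]
  \<comment> \<open>The commutation identity with the even integer \<open>2 * n\<close> replaced by
    a real x. In terms of \<open>\<psi>\<close> it relates the moments at \<open>x + s\<close> and
    at \<open>x + s + 2 * p\<close>.\<close>
  have rec: "moment \<phi> (x + p) * moment \<psi> (x + (2 * p + s)) * moment (\<lambda>_. 1) (x + 2 * s)
      = moment \<psi> (x + s) * moment \<phi> (x + (2 * s + p)) * moment (\<lambda>_. 1) (x + 2 * p)"
    if \<psi>: "bounded_symbol \<psi>" "radial \<psi>" "toeplitz_commute (quasihom s \<psi>) (quasihom p \<phi>)" and x: "x > 2"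
    for \<psi> and x :: real
  proof -
    define sh where "sh = (\<lambda>f a z. f z * complex_of_real (cmod z powr a))"
    have ish: "integrable dA (sh f a)" if "integrable dA f" "a \<ge> 0" for f a
      unfolding sh_def by (rule integrable_mult_cmod_powr[OF that])
    have msh: "moment (sh f a) y = moment f (y + a)" for f a y
      unfolding sh_def by (rule moment_shift)
    have i1: "integrable dA (\<lambda>_. 1 :: complex)" by simp
    have "moment (sh \<phi> p) x * (moment (sh \<psi> (2 * p + s)) x * moment (sh (\<lambda>_. 1) (2 * s)) x)
      = moment (sh \<psi> s) x * (moment (sh \<phi> (2 * s + p)) x * moment (sh (\<lambda>_. 1) (2 * p)) x)"
    proof (rule moment_triple_eq_of_progression[where c = 2 and d = 2])
      fix n :: nat
      \<comment> \<open>Taking \<open>Suc n\<close> starts the progression at 2, since its first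
        exponent must be positive.\<close>
      from toeplitz_commute_moment[OF p assms(3,4) s \<psi>, of "Suc n"]
      show "moment (sh \<phi> p) (2 + 2 * real n) * (moment (sh \<psi> (2 * p + s)) (2 + 2 * real n) * moment (sh (\<lambda>_. 1) (2 * s)) (2 + 2 * real n))
        = moment (sh \<psi> s) (2 + 2 * real n) * (moment (sh \<phi> (2 * s + p)) (2 + 2 * real n) * moment (sh (\<lambda>_. 1) (2 * p)) (2 + 2 * real n))"
        by (simp add: msh algebra_simps)
    qed (use x i\<phi> i1 integrable_bounded_symbol[OF \<psi>(1)] in \<open>auto intro!: ish\<close>)
    then show ?thesis by (simp add: msh mult.assoc)
  qed
  define Z\<phi> where "Z\<phi> = {y. y > 0 \<and> moment \<phi> y = 0}"
  define Z2 where "Z2 = {y. y > 0 \<and> moment \<psi>2 y = 0}"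
  \<comment> \<open>A symbol \<open>\<phi>\<close> vanishing almost everywhere would be constant
    almost everywhere.\<close>
  have "countable Z\<phi>"
    unfolding Z\<phi>_def using assms(5) by (intro countable_moment_zeros i\<phi> assms(4)) blast
  moreover have "countable Z2"
    unfolding Z2_def by (intro countable_moment_zeros i2 assms(9) False)
  \<comment> \<open>All starting points x for which some \<open>x + 2 * p * k + p\<close> or
    \<open>x + 2 * p * k + s\<close> hits a zero. The interval (2,3) serves only as an uncountable
    set of exponents beyond 2.\<close>
  ultimately have "countable (\<Union>k::nat. (\<lambda>y. y - (2 * p * k + p)) ` Z\<phi> \<union> (\<lambda>y. y - (2 * p * k + s)) ` Z2)"
    (is "countable ?Z") by (intro countable_UN countable_Un countable_image) auto
  moreover have "uncountable {2<..<3::real}"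
    by (rule uncountable_open_interval[THEN iffD2]) simp
  ultimately obtain x0 where x0: "x0 \<in> {2<..<3}" "x0 \<notin> ?Z"
    by (meson countable_subset subsetI)
  define c where "c = x0 + s"
  have "x0 > 2" using x0(1) by simp
  then have pos: "x0 + 2 * p * k > 2" "c + 2 * p * k > 2" for k :: nat
  proof -
    have "0 \<le> 2 * real p * real k" by simp
    with \<open>x0 > 2\<close> show "x0 + 2 * p * k > 2" "c + 2 * p * k > 2"
      unfolding c_def of_nat_mult of_nat_numeral by linarith+
  qed
  have nz\<phi>: "moment \<phi> (x0 + 2 * p * k + p) \<noteq> 0" for k :: nat
  proof
    assume "moment \<phi> (x0 + 2 * p * k + p) = 0"
    then have "x0 + 2 * p * k + p \<in> Z\<phi>" using pos(1)[of k] by (simp add: Z\<phi>_def)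
    then have "x0 \<in> (\<lambda>y. y - (2 * p * k + p)) ` Z\<phi>"
      by (intro image_eqI[of _ _ "x0 + 2 * p * k + p"]) auto
    with x0(2) show False by blast
  qed
  have nz2: "moment \<psi>2 (c + 2 * p * k) \<noteq> 0" for k :: nat
  proof
    assume "moment \<psi>2 (c + 2 * p * k) = 0"
    then have "c + 2 * p * k \<in> Z2" using pos(2)[of k] by (simp add: Z2_def)
    then have "x0 \<in> (\<lambda>y. y - (2 * p * k + s)) ` Z2"
      by (intro image_eqI[of _ _ "c + 2 * p * k"]) (auto simp: c_def)
    with x0(2) show False by blast
  qed
  define a where "a = moment \<psi>1 c / moment \<psi>2 c"
  have ratio: "moment \<psi>1 (c + 2 * p * k) = a * moment \<psi>2 (c + 2 * p * k)" for k :: nat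
  proof (induction k)
    case 0
    show ?case using nz2[of 0] by (simp add: a_def)
  next
    case (Suc k)
    define x where "x = x0 + 2 * p * k"
    have x: "x > 2" using pos(1)[of k] by (simp add: x_def)
    \<comment> \<open>\<open>A\<close> and \<open>B\<close> do not involve \<open>\<psi>\<close>, so
      the moments of \<open>\<psi>1\<close> and \<open>\<psi>2\<close> obey the same first-order
      recursion along the progression. Forward propagation of the ratio divides by \<open>A\<close>
      only, so \<open>B\<close> is allowed to vanish.\<close>
    define A where "A = moment \<phi> (x + p) * moment (\<lambda>_. 1) (x + 2 * s)"
    define B where "B = moment \<phi> (x + (2 * s + p)) * moment (\<lambda>_. 1) (x + 2 * p)"
    have A: "A \<noteq> 0"
      using nz\<phi>[of k] moment_1_nonzero[of "x + 2 * s"] x by (simp add: A_def x_def)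
    have e: "x + (2 * p + s) = c + 2 * p * Suc k" "x + s = c + 2 * p * k"
      by (simp_all add: x_def c_def algebra_simps)
    have r1: "A * moment \<psi>1 (c + 2 * p * Suc k) = B * moment \<psi>1 (c + 2 * p * k)"
      using rec[OF assms(6,7,10) x] unfolding e A_def B_def by (simp add: mult_ac)
    have r2: "A * moment \<psi>2 (c + 2 * p * Suc k) = B * moment \<psi>2 (c + 2 * p * k)"
      using rec[OF assms(8,9,11) x] unfolding e A_def B_def by (simp add: mult_ac)
    have "A * moment \<psi>1 (c + 2 * p * Suc k) = A * (a * moment \<psi>2 (c + 2 * p * Suc k))"
      unfolding r1 Suc.IH mult.left_commute[of A a] r2 by (rule mult.left_commute)
    then show ?case using A by simp
  qed
  \<comment> \<open>Its moments vanish along \<open>c + 2 * p * k\<close>, and the progression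
    principle with step \<open>2 * p\<close> extends this to all exponents beyond c.\<close>
  define f where "f = (\<lambda>z. \<psi>1 z - a * \<psi>2 z)"
  have f: "integrable dA f" unfolding f_def using i1 i2 by simp
  have "radial f"
    unfolding radial_def f_def
  proof (intro ballI impI)
    fix z w :: complex assume zw: "z \<in> disk" "w \<in> disk" "cmod z = cmod w"
    then have "\<psi>1 z = \<psi>1 w" "\<psi>2 z = \<psi>2 w"
      using assms(7,9) unfolding radial_def by blast+
    then show "\<psi>1 z - a * \<psi>2 z = \<psi>1 w - a * \<psi>2 w" by simp
  qed
  have "c > 0" using x0(1) by (simp add: c_def add_pos_nonneg)
  have "moment f y = 0" if "y > c" for y
    unfolding moment_def
  proof (rule integral_powr_eq_0_of_progression[OF f cmod_measurable_dA _ _ \<open>c > 0\<close> _ that])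
    show "2 * real p > 0" using p by simp
    show "cmod z \<in> {0..1}" if "z \<in> space dA" for z using that by simp
    fix k :: nat
    have "(\<integral>z. f z * of_real (cmod z powr (c + 2 * real p * real k)) \<partial>dA)
       = moment \<psi>1 (c + 2 * p * k) - a * moment \<psi>2 (c + 2 * p * k)"
    proof -
      have "0 \<le> c + 2 * real p * real k" using \<open>c > 0\<close> by simp
      note i = integrable_mult_cmod_powr[OF i1 this] integrable_mult_cmod_powr[OF i2 this]
      have "(\<integral>z. f z * of_real (cmod z powr (c + 2 * real p * real k)) \<partial>dA)
        = (\<integral>z. \<psi>1 z * of_real (cmod z powr (c + 2 * real p * real k))
             - a * (\<psi>2 z * of_real (cmod z powr (c + 2 * real p * real k))) \<partial>dA)"
        by (simp add: f_def left_diff_distrib mult.assoc)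
      then show ?thesis using i by (simp add: moment_def)
    qed
    then show "(\<integral>z. f z * of_real (cmod z powr (c + 2 * real p * real k)) \<partial>dA) = 0"
      using ratio[of k] by simp
  qed
  then have "AE z in dA. f z = 0"
    by (rule AE_eq_0_of_moment[OF f \<open>radial f\<close>])
  then have "AE z in dA. \<psi>1 z = a * \<psi>2 z"
    by eventually_elim (simp add: f_def)
  then show ?thesis by blast
qed

end
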